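(* If $0<p<1$ and $m\ge2$ is an integer, there is a constant $C=C(p,m)$ such that $w_m(\ell_p^n)\le C$ for all $n\ge1$.
   Context: For $0<p<1$, let $B_{\ell_p^n}=\{x\in\mathbb R^n:\sum_{i=1}^n|x_i|^p\le1\}$ (a non-convex set when $n\ge2$). For a closed bounded set $K\subset\mathbb R^n$ and continuous $f:K\to\mathbb R$, let $E_m(f;K)=\inf_\varphi\max_{x\in K}|f(x)-\varphi(x)|$, the infimum over all real polynomials $\varphi$ on $\mathbb R^n$ of total degree at most $m-1$; let $\Delta_h^m(f;x)=\sum_{j=0}^m(-1)^{m-j}\binom mj f(x+jh)$ and $\omega_m(f;K)=\sup|\Delta_h^m(f;x)|$, the supremum over all $x,h\in\mathbb R^n$ such that all of $x,x+h,\dots,x+mh$ belong to $K$. The Whitney constant is $w_m(K)=\sup\{E_m(f;K): f\in C(K),\ \omega_m(f;K)\le1\}$, and $w_m(\ell_p^n)=w_m(B_{\ell_p^n})$. *)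

theory Defs
  imports "HOL-Analysis.Analysis"
begin

text \<open>
  Since the dimension \<open>n\<close> is quantified inside the theorem, \<open>\<real>\<^sup>n\<close> is the library's
  \<^const>\<open>Euclidean_space\<close>: sequences \<open>nat \<Rightarrow> real\<close> vanishing at all indices \<open>i \<ge> n\<close>, with
  coordinates numbered from \<open>0\<close> and the product topology. Suprema and infima are taken in
  \<^typ>\<open>ereal\<close>, so that they are meaningful without a prior boundedness proof.
\<close>

definition lp_ball :: "real \<Rightarrow> nat \<Rightarrow> (nat \<Rightarrow> real) set" where
  "lp_ball p n = {x \<in> topspace (Euclidean_space n). (\<Sum>i<n. \<bar>x i\<bar> powr p) \<le> 1}"

text \<open>The sum runs over the exponents of the monomials in \<open>n\<close> variables of total degree \<open>\<le> d\<close>.\<close>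

definition multi_indices :: "nat \<Rightarrow> nat \<Rightarrow> (nat \<Rightarrow> nat) set" where
  "multi_indices n d = {\<alpha>. (\<forall>i\<ge>n. \<alpha> i = 0) \<and> (\<Sum>i<n. \<alpha> i) \<le> d}"

definition poly_funs :: "nat \<Rightarrow> nat \<Rightarrow> ((nat \<Rightarrow> real) \<Rightarrow> real) set" where
  "poly_funs n d =
    {\<phi>. \<exists>c :: (nat \<Rightarrow> nat) \<Rightarrow> real.
          \<phi> = (\<lambda>x. \<Sum>\<alpha>\<in>multi_indices n d. c \<alpha> * (\<Prod>i<n. x i ^ \<alpha> i))}"

lemma finite_multi_indices: "finite (multi_indices n d)"
proof -
  have "\<alpha> i \<le> d" if "\<alpha> \<in> multi_indices n d" "i < n" for \<alpha> i
    using that member_le_sum[of i "{..<n}" \<alpha>] by (force simp: multi_indices_def)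
  then have "multi_indices n d \<subseteq>
      {\<alpha>. \<forall>i. (i \<in> {..<n} \<longrightarrow> \<alpha> i \<in> {..d}) \<and> (i \<notin> {..<n} \<longrightarrow> \<alpha> i = 0)}"
    by (auto simp: multi_indices_def)
  then show ?thesis
    by (rule finite_subset) (intro finite_set_of_finite_funs; simp)
qed

definition cont_funs :: "nat \<Rightarrow> (nat \<Rightarrow> real) set \<Rightarrow> ((nat \<Rightarrow> real) \<Rightarrow> real) set" where
  "cont_funs n K = {f. continuous_map (subtopology (Euclidean_space n) K) euclideanreal f}"

text \<open>Intended for \<open>m \<ge> 1\<close>, as \<open>m - 1\<close> is truncated subtraction.\<close>

definition best_approx :: "nat \<Rightarrow> nat \<Rightarrow> ((nat \<Rightarrow> real) \<Rightarrow> real) \<Rightarrow> (nat \<Rightarrow> real) set \<Rightarrow> ereal" where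
  "best_approx n m f K = (INF \<phi>\<in>poly_funs n (m - 1). SUP x\<in>K. ereal \<bar>f x - \<phi> x\<bar>)"

definition shift :: "(nat \<Rightarrow> real) \<Rightarrow> (nat \<Rightarrow> real) \<Rightarrow> nat \<Rightarrow> nat \<Rightarrow> real" where
  "shift x h j = (\<lambda>i. x i + real j * h i)"

definition fin_diff ::
    "nat \<Rightarrow> (nat \<Rightarrow> real) \<Rightarrow> ((nat \<Rightarrow> real) \<Rightarrow> real) \<Rightarrow> (nat \<Rightarrow> real) \<Rightarrow> real" where
  "fin_diff m h f x = (\<Sum>j\<le>m. (- 1) ^ (m - j) * real (m choose j) * f (shift x h j))"

definition modulus :: "nat \<Rightarrow> nat \<Rightarrow> ((nat \<Rightarrow> real) \<Rightarrow> real) \<Rightarrow> (nat \<Rightarrow> real) set \<Rightarrow> ereal" where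
  "modulus n m f K =
    (SUP (x, h) \<in> {(x, h). x \<in> topspace (Euclidean_space n) \<and> h \<in> topspace (Euclidean_space n) \<and>
                          (\<forall>j\<le>m. shift x h j \<in> K)}.
       ereal \<bar>fin_diff m h f x\<bar>)"

definition whitney_const :: "nat \<Rightarrow> nat \<Rightarrow> (nat \<Rightarrow> real) set \<Rightarrow> ereal" where
  "whitney_const n m K = (SUP f\<in>{f \<in> cont_funs n K. modulus n m f K \<le> 1}. best_approx n m f K)"

definition whitney_const_lp :: "nat \<Rightarrow> real \<Rightarrow> nat \<Rightarrow> ereal" where
  "whitney_const_lp m p n = whitney_const n m (lp_ball p n)"

end

theory Submission
  imports Defs
begin

text \<open>
  Let \<open>d = m - 1\<close>, and let \<open>f\<close> be a continuous function on the \<open>\<ell>\<^sub>p\<close> ball whose differences of order \<open>m\<close> are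
  bounded by \<open>1\<close>. The approximating polynomial is explicit: it is the sparse interpolant, whose coefficient at
  a monomial is read off from values of \<open>f\<close> at vectors supported by the variables of this monomial (\<open>coef\<close>,
  \<open>interpolant\<close>). A monomial of degree at most \<open>d\<close> has at most \<open>d\<close> variables, so these coefficients are
  bounded by a multiple of the supremum of \<open>\<bar>f\<bar>\<close> that does not depend on the dimension. The residual \<open>g\<close> has the
  same differences as \<open>f\<close>, and all its sparse coefficients vanish.

  Let \<open>M\<close> be the supremum of \<open>\<bar>g\<bar>\<close>; it is finite since the ball is compact. The crucial estimate is
  \<open>M \<le> M / 2 + W\<close> with \<open>W\<close> independent of the dimension (\<open>grouped_contraction\<close>). To bound \<open>g\<close> at a point \<open>x\<close>,
  split the coordinates into boundedly many groups, each of which is a single coordinate or has a small share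
  \<open>\<eta>\<close> of the sum of the \<open>\<bar>x i\<bar> powr p\<close>. The normalised parts of \<open>x\<close> span a copy of an \<open>\<ell>\<^sub>p\<close> ball of bounded
  dimension, and there \<open>g\<close> is close to its sparse interpolant. In this interpolant the monomials involving single
  coordinates only have coefficient zero, and the others have coefficients of order \<open>M\<close>. At \<open>x\<close> these other
  monomials are small in total, because the norms of the small groups add up to at most \<open>\<eta> powr (1 / p - 1)\<close> up
  to a constant. This tends to zero with \<open>\<eta>\<close> precisely because \<open>p < 1\<close>.

  What remains is Whitney's theorem in a fixed dimension (\<open>whitney_bounded_dimension\<close>). It follows from the theorem
  on an interval by interpolating coordinate by coordinate on a small cube and then comparing, along rays from the
  origin, with one-variable approximations of the right degree. On an interval (\<open>whitney_interval\<close>) a similar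
  contraction works: the error is controlled on a fixed lattice by solving the difference equation, and a short step
  away from the lattice costs at most half of the supremum.
\<close>

section \<open>Finite differences on a line\<close>

definition line_diff :: "nat \<Rightarrow> real \<Rightarrow> (real \<Rightarrow> real) \<Rightarrow> real \<Rightarrow> real" where
  "line_diff m h u x = (\<Sum>j\<le>m. (- 1) ^ (m - j) * real (m choose j) * u (x + real j * h))"

text \<open>
  Pascal's rule peels off one first-order difference. It makes induction on the order of the
  difference possible, and with it the proof that differences annihilate polynomials of lower degree.
\<close>
lemma line_diff_Suc: "line_diff (Suc m) h u x = line_diff m h (\<lambda>s. u (s + h) - u s) x"
proof -
  let ?t = "\<lambda>j. u (x + real j * h)"
  have "line_diff (Suc m) h u x =
      (-1) ^ Suc m * ?t 0 + (\<Sum>j\<le>m. (-1) ^ (m - j) * real (Suc m choose Suc j) * ?t (Suc j))"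
    unfolding line_diff_def by (subst sum.atMost_Suc_shift) simp
  also have "(\<Sum>j\<le>m. (-1) ^ (m - j) * real (Suc m choose Suc j) * ?t (Suc j)) =
      (\<Sum>j\<le>m. (-1) ^ (m - j) * real (m choose j) * ?t (Suc j)) +
      (\<Sum>j\<le>m. (-1) ^ (m - j) * real (m choose Suc j) * ?t (Suc j))"
    by (simp add: sum.distrib algebra_simps)
  also have "(-1) ^ Suc m * ?t 0 + (\<dots>) = (\<Sum>j\<le>m. (-1) ^ (m - j) * real (m choose j) * ?t (Suc j)) +
      ((-1) ^ Suc m * ?t 0 + (\<Sum>j\<le>m. (-1) ^ (m - j) * real (m choose Suc j) * ?t (Suc j)))"
    by simp
  also have "(-1) ^ Suc m * ?t 0 + (\<Sum>j\<le>m. (-1) ^ (m - j) * real (m choose Suc j) * ?t (Suc j)) =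
      (\<Sum>j\<le>Suc m. (-1) ^ (Suc m - j) * real (m choose j) * ?t j)"
    by (subst sum.atMost_Suc_shift) simp
  also have "\<dots> = (\<Sum>j\<le>m. (-1) ^ (Suc m - j) * real (m choose j) * ?t j)"
    by simp
  also have "\<dots> = - (\<Sum>j\<le>m. (-1) ^ (m - j) * real (m choose j) * ?t j)"
    unfolding sum_negf[symmetric] by (rule sum.cong) (auto simp: Suc_diff_le)
  finally show ?thesis
    by (simp add: line_diff_def sum_subtractf[symmetric] algebra_simps)
qed

lemma line_diff_minus: "line_diff m h (\<lambda>s. u s - v s) x = line_diff m h u x - line_diff m h v x"
  by (simp add: line_diff_def sum_subtractf[symmetric] algebra_simps)

lemma line_diff_sum:
  "line_diff m h (\<lambda>s. \<Sum>k\<in>A. c k * u k s) x = (\<Sum>k\<in>A. c k * line_diff m h (u k) x)"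
proof -
  have "line_diff m h (\<lambda>s. \<Sum>k\<in>A. c k * u k s) x =
     (\<Sum>j\<le>m. \<Sum>k\<in>A. c k * ((- 1) ^ (m - j) * real (m choose j) * u k (x + real j * h)))"
    by (simp add: line_diff_def sum_distrib_left mult_ac)
  also have "\<dots> = (\<Sum>k\<in>A. c k * line_diff m h (u k) x)"
    by (subst sum.swap) (simp add: line_diff_def sum_distrib_left)
  finally show ?thesis .
qed

lemma line_diff_power: "k < m \<Longrightarrow> line_diff m h (\<lambda>s. s ^ k) x = 0"
proof (induction m arbitrary: k x)
  case (Suc m)
  have "(s + h) ^ k - s ^ k = (\<Sum>i<k. (real (k choose i) * h ^ (k - i)) * s ^ i)" for s
    by (simp add: binomial_ring lessThan_Suc_atMost[symmetric] mult_ac)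
  then show ?case
    using Suc by (simp add: line_diff_Suc line_diff_sum)
qed simp

lemma line_diff_poly: "d < m \<Longrightarrow> line_diff m h (\<lambda>s. \<Sum>k\<le>d. c k * s ^ k) x = 0"
  by (simp add: line_diff_sum line_diff_power)

text \<open>
  Solving the difference for its last value expresses each value of \<open>e\<close> on the progression through the
  \<open>m\<close> preceding ones, with coefficients of total size less than \<open>2 ^ m\<close>. So the values grow at most
  geometrically from \<open>m\<close> zeros. Applied to the difference between a function and its interpolating
  polynomial at \<open>m\<close> consecutive points, this is the discrete form of Whitney's theorem.
\<close>
lemma vanishing_start_growth:
  assumes zero: "\<And>i. i < m \<Longrightarrow> e (x + real i * h) = 0"
    and diff: "\<And>i. i + m \<le> n \<Longrightarrow> \<bar>line_diff m h e (x + real i * h)\<bar> \<le> 1"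
    and "i \<le> n"
  shows "\<bar>e (x + real i * h)\<bar> \<le> (2 ^ m + 1) ^ i"
  using \<open>i \<le> n\<close>
proof (induction i rule: less_induct)
  case (less i)
  show ?case
  proof (cases "i < m")
    case True
    then show ?thesis using zero by simp
  next
    case False
    define k where "k = i - m"
    have i: "i = k + m" using False by (simp add: k_def)
    let ?y = "x + real k * h"
    show ?thesis
    proof (cases m)
      case 0
      then show ?thesis
        using diff[of i] less.prems order_trans[OF _ one_le_power[of "2::real" i]]
        by (simp add: line_diff_def)
    next
      case (Suc m')
      have tri: "\<bar>c\<bar> \<le> \<bar>a\<bar> + \<bar>b\<bar>" if "a = b + c" for a b c :: real
        using that by linarith
      have "line_diff m h e ?y =
          (\<Sum>j<m. (- 1) ^ (m - j) * real (m choose j) * e (?y + real j * h)) + e (?y + real m * h)"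
        by (simp add: line_diff_def lessThan_Suc_atMost[symmetric])
      moreover have "?y + real m * h = x + real i * h"
        by (simp add: i algebra_simps)
      ultimately have "line_diff m h e ?y =
          (\<Sum>j<m. (- 1) ^ (m - j) * real (m choose j) * e (?y + real j * h)) + e (x + real i * h)"
        by simp
      then have "\<bar>e (x + real i * h)\<bar> \<le> \<bar>line_diff m h e ?y\<bar> +
          \<bar>\<Sum>j<m. (- 1) ^ (m - j) * real (m choose j) * e (?y + real j * h)\<bar>"
        by (rule tri)
      also have "\<bar>line_diff m h e ?y\<bar> \<le> 1"
        using diff[of k] less.prems i by simp
      also have "\<bar>\<Sum>j<m. (- 1) ^ (m - j) * real (m choose j) * e (?y + real j * h)\<bar> \<le>
          (\<Sum>j<m. real (m choose j) * (2 ^ m + 1) ^ (i - 1))"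
      proof (rule order_trans[OF sum_abs], rule sum_mono)
        fix j assume j: "j \<in> {..<m}"
        have "\<bar>e (x + real (k + j) * h)\<bar> \<le> (2 ^ m + 1) ^ (k + j)"
          using less.IH[of "k + j"] less.prems j by (simp add: i)
        also have "\<dots> \<le> (2 ^ m + 1) ^ (i - 1)"
          by (rule power_increasing) (use j in \<open>auto simp: i\<close>)
        finally have "\<bar>e (?y + real j * h)\<bar> \<le> (2 ^ m + 1) ^ (i - 1)"
          by (simp add: algebra_simps)
        then show "\<bar>(- 1) ^ (m - j) * real (m choose j) * e (?y + real j * h)\<bar> \<le>
            real (m choose j) * (2 ^ m + 1) ^ (i - 1)"
          by (simp add: abs_mult mult_left_mono)
      qed
      also have "\<dots> \<le> (\<Sum>j\<le>m. real (m choose j)) * (2 ^ m + 1) ^ (i - 1)"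
        unfolding sum_distrib_right by (rule sum_mono2) auto
      also have "(\<Sum>j\<le>m. real (m choose j)) = 2 ^ m"
        using choose_row_sum[of m] by (metis of_nat_sum of_nat_power of_nat_numeral)
      also have "1 + 2 ^ m * (2 ^ m + 1) ^ (i - 1) \<le> (2 ^ m + 1 :: real) ^ i"
      proof -
        have "(2 ^ m + 1 :: real) ^ i = 2 ^ m * (2 ^ m + 1) ^ (i - 1) + (2 ^ m + 1) ^ (i - 1)"
          by (cases i) (auto simp: i Suc algebra_simps)
        moreover have "(1::real) \<le> (2 ^ m + 1) ^ (i - 1)"
          by (rule one_le_power) simp
        ultimately show ?thesis by linarith
      qed
      finally show ?thesis by simp
    qed
  qed
qed

text \<open>
  The weights \<open>w k j\<close> are the coefficients of the Lagrange basis polynomials, that is, the entries of the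
  inverse Vandermonde matrix of the nodes. The first identity says that \<open>w k\<close> reads off the coefficient
  of degree \<open>k\<close> from the values at the nodes, the second that the polynomial with coefficients
  \<open>\<Sum>j\<le>d. w k j * a j\<close> takes the prescribed values \<open>a\<close>.
\<close>
lemma lagrange_weights:
  fixes t :: "nat \<Rightarrow> real"
  assumes inj: "inj_on t {..d}"
  obtains w where
    "\<And>i k. i \<le> d \<Longrightarrow> k \<le> d \<Longrightarrow> (\<Sum>j\<le>d. w k j * t j ^ i) = (if i = k then 1 else 0)"
    "\<And>i j. i \<le> d \<Longrightarrow> j \<le> d \<Longrightarrow> (\<Sum>k\<le>d. w k j * t i ^ k) = (if i = j then 1 else 0)"
proof -
  define l where "l = (\<lambda>j. smult (1 / (\<Prod>i\<in>{..d} - {j}. t j - t i)) (\<Prod>i\<in>{..d} - {j}. [:- t i, 1:]))"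
  have deg: "degree (l j) \<le> d" if "j \<le> d" for j
  proof -
    have "degree (\<Prod>i\<in>{..d} - {j}. [:- t i, 1:]) \<le> sum (degree \<circ> (\<lambda>i. [:- t i, 1:])) ({..d} - {j})"
      by (rule degree_prod_sum_le) simp
    also have "\<dots> = d" using that by simp
    finally show ?thesis unfolding l_def using degree_smult_le order_trans by blast
  qed
  have val: "poly (l j) (t i) = (if i = j then 1 else 0)" if "i \<le> d" "j \<le> d" for i j
  proof (cases "i = j")
    case True
    have "(\<Prod>i\<in>{..d} - {j}. t j - t i) \<noteq> 0"
      using inj that by (auto simp: inj_on_def)
    then show ?thesis using True by (simp add: l_def poly_prod)
  next
    case False
    then have "(\<Prod>k\<in>{..d} - {j}. t i - t k) = 0"
      using that by (intro prod_zero) auto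
    then show ?thesis using False by (simp add: l_def poly_prod)
  qed
  have expand: "poly (l j) x = (\<Sum>k\<le>d. coeff (l j) k * x ^ k)" if "j \<le> d" for j x
  proof -
    have "poly (l j) x = (\<Sum>k\<le>degree (l j). coeff (l j) k * x ^ k)" by (rule poly_altdef)
    also have "\<dots> = (\<Sum>k\<le>d. coeff (l j) k * x ^ k)"
      by (rule sum.mono_neutral_left) (use deg[OF that] in \<open>auto simp: le_degree\<close>)
    finally show ?thesis .
  qed
  show thesis
  proof (rule that[of "\<lambda>k j. coeff (l j) k"])
    fix i j assume "i \<le> d" "j \<le> d"
    then show "(\<Sum>k\<le>d. coeff (l j) k * t i ^ k) = (if i = j then 1 else 0)"
      using expand val by metis
  next
    fix i k assume i: "i \<le> d" and k: "k \<le> d"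
    define q where "q = monom 1 i - (\<Sum>j\<le>d. smult (t j ^ i) (l j))"
    \<comment> \<open>The polynomial reproduces the monomial at \<open>d + 1\<close> nodes, so their difference has too many roots.\<close>
    have "q = 0"
    proof (rule ccontr)
      assume "q \<noteq> 0"
      have dq: "degree q \<le> d"
        unfolding q_def
        by (intro degree_diff_le degree_sum_le)
           (use i deg in \<open>auto simp: degree_monom_eq intro: order_trans[OF degree_smult_le]\<close>)
      have "t ` {..d} \<subseteq> {x. poly q x = 0}"
      proof (rule image_subsetI)
        fix a assume "a \<in> {..d}"
        then show "t a \<in> {x. poly q x = 0}"
          by (simp add: q_def poly_monom poly_sum val sum.delta if_distrib cong: if_cong)
      qed
      then have "card (t ` {..d}) \<le> card {x. poly q x = 0}"
        using poly_roots_finite[OF \<open>q \<noteq> 0\<close>] card_mono by blast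
      also have "\<dots> \<le> degree q"
        using card_poly_roots_bound[OF \<open>q \<noteq> 0\<close>] .
      finally show False using dq card_image[OF inj] by simp
    qed
    then have "coeff (monom 1 i - (\<Sum>j\<le>d. smult (t j ^ i) (l j))) k = 0"
      by (simp add: q_def)
    then show "(\<Sum>j\<le>d. coeff (l j) k * t j ^ i) = (if i = k then 1 else 0)"
      by (simp add: coeff_sum mult.commute)
  qed
qed

section \<open>Whitney's theorem on an interval\<close>
text \<open>
  A self-improving estimate: a bound for the supremum in terms of half of itself. Mere boundedness of \<open>g\<close>
  thus turns into an explicit bound, which is how constants independent of \<open>B\<close> arise below.
\<close>
lemma sup_halving:
  fixes g :: "'a \<Rightarrow> real"
  assumes bounded: "\<And>x. x \<in> S \<Longrightarrow> \<bar>g x\<bar> \<le> B"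
    and half: "\<And>M x. (\<And>z. z \<in> S \<Longrightarrow> \<bar>g z\<bar> \<le> M) \<Longrightarrow> x \<in> S \<Longrightarrow> \<bar>g x\<bar> \<le> M / 2 + C"
    and "x \<in> S"
  shows "\<bar>g x\<bar> \<le> 2 * C"
proof -
  let ?M = "SUP z\<in>S. \<bar>g z\<bar>"
  have bdd: "bdd_above ((\<lambda>z. \<bar>g z\<bar>) ` S)"
    using bounded by (auto intro!: bdd_aboveI)
  have le: "\<bar>g z\<bar> \<le> ?M" if "z \<in> S" for z
    by (rule cSUP_upper[OF that bdd])
  have "?M \<le> ?M / 2 + C"
    by (rule cSUP_least) (use \<open>x \<in> S\<close> half le in auto)
  then show ?thesis using le[OF \<open>x \<in> S\<close>] by linarith
qed

lemma weights_extract_coeff: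
  fixes w :: "nat \<Rightarrow> nat \<Rightarrow> real"
  assumes "\<And>i k. i \<le> d \<Longrightarrow> k \<le> d \<Longrightarrow> (\<Sum>j\<le>d. w k j * t j ^ i) = (if i = k then 1 else 0)"
    and "k \<le> d"
  shows "(\<Sum>j\<le>d. w k j * (\<Sum>i\<le>d. c i * t j ^ i)) = c k"
proof -
  have "(\<Sum>j\<le>d. w k j * (\<Sum>i\<le>d. c i * t j ^ i)) = (\<Sum>i\<le>d. c i * (\<Sum>j\<le>d. w k j * t j ^ i))"
    unfolding sum_distrib_left by (subst sum.swap) (simp add: mult_ac)
  also have "\<dots> = (\<Sum>i\<le>d. c i * (if i = k then 1 else 0))"
    using assms by (intro sum.cong) auto
  also have "\<dots> = c k"
    using \<open>k \<le> d\<close> by (simp add: if_distrib sum.delta cong: if_cong)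
  finally show ?thesis .
qed

lemma weights_interpolate:
  fixes w :: "nat \<Rightarrow> nat \<Rightarrow> real"
  assumes "\<And>i j. i \<le> d \<Longrightarrow> j \<le> d \<Longrightarrow> (\<Sum>k\<le>d. w k j * t i ^ k) = (if i = j then 1 else 0)"
    and "i \<le> d"
  shows "(\<Sum>k\<le>d. (\<Sum>j\<le>d. w k j * a j) * t i ^ k) = a i"
proof -
  have "(\<Sum>k\<le>d. (\<Sum>j\<le>d. w k j * a j) * t i ^ k) = (\<Sum>j\<le>d. a j * (\<Sum>k\<le>d. w k j * t i ^ k))"
    unfolding sum_distrib_left sum_distrib_right by (subst sum.swap) (simp add: mult_ac)
  also have "\<dots> = (\<Sum>j\<le>d. a j * (if i = j then 1 else 0))"
    using assms by (intro sum.cong) auto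
  also have "\<dots> = a i"
    using \<open>i \<le> d\<close> by (simp add: if_distrib sum.delta cong: if_cong)
  finally show ?thesis .
qed

text \<open>
  Almost equicontinuity: with enough room in the direction of the step \<open>h\<close>, a single step changes \<open>u\<close> by
  at most half of its supremum, up to a constant. On the progression with step \<open>h\<close> the function is close to
  the polynomial \<open>P\<close> interpolating it at the first \<open>d + 1\<close> points. This polynomial is bounded on a long
  interval, of length \<open>n\<close> in units of \<open>h\<close>, and such a polynomial changes little over one unit.
\<close>
lemma short_step_oscillation:
  obtains n :: nat and C :: real where "n > 0" "C \<ge> 0"
    "\<And>u x h M. (\<And>i. i \<le> n \<Longrightarrow> \<bar>u (x + real i * h)\<bar> \<le> M) \<Longrightarrow>
      (\<And>i. i + Suc d \<le> n \<Longrightarrow> \<bar>line_diff (Suc d) h u (x + real i * h)\<bar> \<le> 1) \<Longrightarrow>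
      \<bar>u (x + h) - u x\<bar> \<le> M / 2 + C"
proof -
  obtain w where
    w1: "\<And>i k. i \<le> d \<Longrightarrow> k \<le> d \<Longrightarrow> (\<Sum>j\<le>d. w k j * real j ^ i) = (if i = k then 1 else 0)" and
    w2: "\<And>i j. i \<le> d \<Longrightarrow> j \<le> d \<Longrightarrow> (\<Sum>k\<le>d. w k j * real i ^ k) = (if i = j then 1 else 0)"
    by (rule lagrange_weights[of real d]) auto
  define \<Lambda> where "\<Lambda> = (\<Sum>k\<le>d. \<Sum>j\<le>d. \<bar>w k j\<bar>)"
  have "\<Lambda> \<ge> 0" by (simp add: \<Lambda>_def sum_nonneg)
  define r where "r = Suc (nat \<lceil>2 * \<Lambda>\<rceil>)"
  have r: "real r \<ge> 2 * \<Lambda>" "real r \<ge> 1" unfolding r_def by linarith+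
  define n where "n = Suc d * r"
  define E :: real where "E = (2 ^ Suc d + 1) ^ n"
  have "n \<ge> 1" using r by (simp add: n_def)
  have osc: "\<bar>v 1 - v 0\<bar> \<le> M / 2 + 3 * E"
    if bd: "\<And>i. i \<le> n \<Longrightarrow> \<bar>v (real i)\<bar> \<le> M"
      and diff: "\<And>i. i + Suc d \<le> n \<Longrightarrow> \<bar>line_diff (Suc d) 1 v (real i)\<bar> \<le> 1" for v :: "real \<Rightarrow> real" and M
  proof -
    define c where "c k = (\<Sum>j\<le>d. w k j * v (real j))" for k
    define P where "P s = (\<Sum>k\<le>d. c k * s ^ k)" for s :: real
    have eq: "P (real i) = v (real i)" if "i \<le> d" for i
      using weights_interpolate[of d w real i "\<lambda>j. v (real j)"] w2 that
      by (simp add: P_def c_def)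
    have close: "\<bar>v (real i) - P (real i)\<bar> \<le> E" if "i \<le> n" for i
    proof -
      have "\<bar>v (0 + real i * 1) - P (0 + real i * 1)\<bar> \<le> (2 ^ Suc d + 1) ^ i"
      proof (rule vanishing_start_growth[where n = n and x = 0 and h = 1 and e = "\<lambda>s. v s - P s"])
        fix i assume "i + Suc d \<le> n"
        moreover have "line_diff (Suc d) 1 P (real i) = 0"
          unfolding P_def by (rule line_diff_poly) simp
        ultimately show "\<bar>line_diff (Suc d) 1 (\<lambda>s. v s - P s) (0 + real i * 1)\<bar> \<le> 1"
          using diff by (simp add: line_diff_minus)
      qed (use eq that in auto)
      also have "\<dots> \<le> E" unfolding E_def by (rule power_increasing) (use that in auto)
      finally show ?thesis by simp
    qed
    have PB: "\<bar>P (real i)\<bar> \<le> M + E" if "i \<le> n" for i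
      using bd[OF that] close[OF that] by linarith
    have ME: "M + E \<ge> 0" using PB[of 0] by simp
    \<comment> \<open>The numbers \<open>c k * r ^ k\<close> are the coefficients of \<open>s \<mapsto> P (r * s)\<close>, whose values at \<open>0, \<dots>, d\<close> are known
      to be bounded.\<close>
    have b: "\<bar>c k * real r ^ k\<bar> \<le> (\<Sum>j\<le>d. \<bar>w k j\<bar>) * (M + E)" if "k \<le> d" for k
    proof -
      have "c k * real r ^ k = (\<Sum>j\<le>d. w k j * (\<Sum>i\<le>d. (c i * real r ^ i) * real j ^ i))"
        using weights_extract_coeff[of d w real k "\<lambda>i. c i * real r ^ i"] w1 that by simp
      also have "\<dots> = (\<Sum>j\<le>d. w k j * P (real (r * j)))"
        by (simp add: P_def power_mult_distrib mult_ac)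
      also have "\<bar>\<dots>\<bar> \<le> (\<Sum>j\<le>d. \<bar>w k j\<bar> * (M + E))"
      proof (rule order_trans[OF sum_abs], rule sum_mono)
        fix j assume "j \<in> {..d}"
        then have "r * j \<le> n"
          unfolding n_def mult.commute[of r] by (intro mult_right_mono) auto
        then show "\<bar>w k j * P (real (r * j))\<bar> \<le> \<bar>w k j\<bar> * (M + E)"
          unfolding abs_mult by (intro mult_left_mono PB) auto
      qed
      finally show ?thesis by (simp add: sum_distrib_right)
    qed
    have "\<bar>P 1 - P 0\<bar> \<le> (M + E) / 2"
    proof -
      have "P 1 - P 0 = (\<Sum>k\<in>{..d} - {0}. c k)"
        by (simp add: P_def sum_diff1 power_0_left if_distrib sum.delta cong: if_cong)
      also have "\<bar>\<dots>\<bar> \<le> (\<Sum>k\<in>{..d} - {0}. (\<Sum>j\<le>d. \<bar>w k j\<bar>) * (M + E) / real r)"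
      proof (rule order_trans[OF sum_abs], rule sum_mono)
        fix k assume k: "k \<in> {..d} - {0}"
        have "\<bar>c k\<bar> * real r \<le> \<bar>c k\<bar> * real r ^ k"
          using k r by (intro mult_left_mono self_le_power) auto
        also have "\<dots> \<le> (\<Sum>j\<le>d. \<bar>w k j\<bar>) * (M + E)"
          using b[of k] k by (simp add: abs_mult)
        finally show "\<bar>c k\<bar> \<le> (\<Sum>j\<le>d. \<bar>w k j\<bar>) * (M + E) / real r"
          using r by (simp add: field_simps)
      qed
      also have "\<dots> \<le> (\<Sum>k\<le>d. (\<Sum>j\<le>d. \<bar>w k j\<bar>) * (M + E) / real r)"
        by (rule sum_mono2) (use ME in \<open>auto intro!: divide_nonneg_nonneg mult_nonneg_nonneg sum_nonneg\<close>)
      also have "\<dots> = \<Lambda> * ((M + E) / real r)"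
        by (simp add: \<Lambda>_def sum_distrib_right sum_divide_distrib)
      also have "\<dots> \<le> (M + E) / 2"
        using mult_right_mono[OF r(1) ME] r(2) by (simp add: field_simps)
      finally show ?thesis .
    qed
    moreover have "E \<ge> 0" by (simp add: E_def)
    moreover have "\<bar>v 1 - P 1\<bar> \<le> E" "\<bar>v 0 - P 0\<bar> \<le> E"
      using close[of 1] close[of 0] \<open>n \<ge> 1\<close> by auto
    ultimately show ?thesis unfolding abs_le_iff by argo
  qed
  show thesis
  proof (rule that[of n "3 * E"])
    show "n > 0" using \<open>n \<ge> 1\<close> by simp
    show "3 * E \<ge> 0" by (simp add: E_def)
    fix u :: "real \<Rightarrow> real" and x h M
    assume "\<And>i. i \<le> n \<Longrightarrow> \<bar>u (x + real i * h)\<bar> \<le> M"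
      and "\<And>i. i + Suc d \<le> n \<Longrightarrow> \<bar>line_diff (Suc d) h u (x + real i * h)\<bar> \<le> 1"
    then show "\<bar>u (x + h) - u x\<bar> \<le> M / 2 + 3 * E"
      using osc[of "\<lambda>s. u (x + s * h)" M] by (simp add: line_diff_def algebra_simps)
  qed
qed

text \<open>
  Take the polynomial that interpolates \<open>u\<close> at \<open>d + 1\<close> consecutive points of a fixed lattice. On the lattice
  the error is bounded by \<open>vanishing_start_growth\<close>. Every other point is reached from a lattice point by one
  short step along which there is room to continue, so that \<open>short_step_oscillation\<close> bounds the supremum
  \<open>M\<close> of the error by \<open>M / 2\<close> plus a constant.
\<close>
lemma whitney_interval:
  obtains W :: real where "W \<ge> 0"
    "\<And>u B. (\<And>s. \<bar>s\<bar> \<le> 1 \<Longrightarrow> \<bar>u s\<bar> \<le> B) \<Longrightarrow>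
      (\<And>x h. \<bar>x\<bar> \<le> 1 \<Longrightarrow> \<bar>x + real (Suc d) * h\<bar> \<le> 1 \<Longrightarrow> \<bar>line_diff (Suc d) h u x\<bar> \<le> 1) \<Longrightarrow>
      \<exists>c. \<forall>s. \<bar>s\<bar> \<le> 1 \<longrightarrow> \<bar>u s - (\<Sum>k\<le>d. c k * s ^ k)\<bar> \<le> W"
proof -
  obtain n C where "n > 0" "C \<ge> 0" and osc:
    "\<And>u x h M. (\<And>i. i \<le> n \<Longrightarrow> \<bar>u (x + real i * h)\<bar> \<le> M) \<Longrightarrow>
      (\<And>i. i + Suc d \<le> n \<Longrightarrow> \<bar>line_diff (Suc d) h u (x + real i * h)\<bar> \<le> 1) \<Longrightarrow>
      \<bar>u (x + h) - u x\<bar> \<le> M / 2 + C"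
    using short_step_oscillation[of d thesis] by blast
  define q where "q = n + d"
  have q: "real q > 0" "n \<le> q" "d \<le> 2 * q" using \<open>n > 0\<close> by (auto simp: q_def)
  define t where "t = (\<lambda>i::nat. - 1 + real i * (1 / real q))"
  define E :: real where "E = (2 ^ Suc d + 1) ^ (2 * q)"
  have "E \<ge> 0" by (simp add: E_def)
  have t: "\<bar>t i\<bar> \<le> 1" if "i \<le> 2 * q" for i
  proof -
    have "real i \<le> 2 * real q" using that by linarith
    then show ?thesis using q by (simp add: t_def abs_le_iff field_simps)
  qed
  have "inj_on t {..d}" using q by (auto simp: inj_on_def t_def)
  then obtain w where
    w: "\<And>i j. i \<le> d \<Longrightarrow> j \<le> d \<Longrightarrow> (\<Sum>k\<le>d. w k j * t i ^ k) = (if i = j then 1 else 0)"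
    using lagrange_weights by metis
  show thesis
  proof (rule that[of "2 * (C + E)"])
    show "2 * (C + E) \<ge> 0" using \<open>C \<ge> 0\<close> \<open>E \<ge> 0\<close> by simp
    fix u :: "real \<Rightarrow> real" and B
    assume bd: "\<And>s. \<bar>s\<bar> \<le> 1 \<Longrightarrow> \<bar>u s\<bar> \<le> B"
      and diff: "\<And>x h. \<bar>x\<bar> \<le> 1 \<Longrightarrow> \<bar>x + real (Suc d) * h\<bar> \<le> 1 \<Longrightarrow> \<bar>line_diff (Suc d) h u x\<bar> \<le> 1"
    define c where "c k = (\<Sum>j\<le>d. w k j * u (t j))" for k
    define g where "g s = u s - (\<Sum>k\<le>d. c k * s ^ k)" for s
    have gdiff: "line_diff (Suc d) h g x = line_diff (Suc d) h u x" for h x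
      unfolding g_def line_diff_minus by (simp add: line_diff_poly)
    have zero: "g (t i) = 0" if "i \<le> d" for i
      using weights_interpolate[of d w t i "\<lambda>j. u (t j)"] w that by (simp add: g_def c_def)
    have lattice: "\<bar>g (t i)\<bar> \<le> E" if "i \<le> 2 * q" for i
    proof -
      have "\<bar>g (- 1 + real i * (1 / real q))\<bar> \<le> (2 ^ Suc d + 1) ^ i"
      proof (rule vanishing_start_growth[where n = "2 * q"])
        fix i assume "i + Suc d \<le> 2 * q"
        then have "\<bar>t i\<bar> \<le> 1" "\<bar>t (i + Suc d)\<bar> \<le> 1" by (intro t; simp)+
        then show "\<bar>line_diff (Suc d) (1 / real q) g (- 1 + real i * (1 / real q))\<bar> \<le> 1"
          unfolding gdiff by (intro diff) (simp_all add: t_def algebra_simps add_divide_distrib)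
      qed (use zero that in \<open>auto simp: t_def\<close>)
      also have "\<dots> \<le> E" unfolding E_def by (rule power_increasing) (use that in auto)
      finally show ?thesis by (simp add: t_def)
    qed
    have "\<bar>g s\<bar> \<le> 2 * (C + E)" if "s \<in> {-1..1}" for s
    proof (rule sup_halving[where g = g, OF _ _ that])
      fix s :: real assume "s \<in> {-1..1}"
      then have s: "\<bar>s\<bar> \<le> 1" by auto
      have "\<bar>\<Sum>k\<le>d. c k * s ^ k\<bar> \<le> (\<Sum>k\<le>d. \<bar>c k\<bar>)"
        by (rule order_trans[OF sum_abs sum_mono])
           (use s in \<open>auto simp: abs_mult power_abs intro!: mult_left_le power_le_one\<close>)
      then show "\<bar>g s\<bar> \<le> B + (\<Sum>k\<le>d. \<bar>c k\<bar>)"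
        using bd[OF s] by (simp add: g_def)
    next
      fix M y assume M: "\<And>z. z \<in> {-1..1} \<Longrightarrow> \<bar>g z\<bar> \<le> M" and y: "y \<in> {-1..1::real}"
      \<comment> \<open>The step has to point towards the far end of the interval: upwards from the lattice point below
        a negative \<open>y\<close>, downwards from the one above a positive \<open>y\<close>.\<close>
      have "\<exists>i h. i \<le> 2 * q \<and> y = t i + h \<and> t i + real n * h \<in> {-1..1}"
      proof (cases "y \<le> 0")
        case True
        define i where "i = nat \<lfloor>(y + 1) * q\<rfloor>"
        have "(y + 1) * q \<ge> 0" using y by simp
        then have i: "real i \<le> (y + 1) * q" "(y + 1) * q < real i + 1"
          unfolding i_def by linarith+
        have "(y + 1) * q \<le> q" using True q by (simp add: algebra_simps mult_nonpos_nonneg)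
        with i have "real i \<le> real q" by linarith
        then have iq: "i \<le> 2 * q" by linarith
        have "(y - t i) * q = (y + 1) * q - real i"
          using q by (simp add: t_def field_simps)
        with i have "0 \<le> (y - t i) * q" "(y - t i) * q < 1" by linarith+
        with q have h: "0 \<le> y - t i" "(y - t i) * q < 1" by (auto simp: zero_le_mult_iff)
        have "real n * (y - t i) \<le> real q * (y - t i)"
          using q h by (intro mult_right_mono) auto
        then have "real n * (y - t i) \<le> 1" "real n * (y - t i) \<ge> 0" using h by (auto simp: mult.commute)
        moreover have "t i \<le> 0" using h True by simp
        ultimately have "t i + real n * (y - t i) \<in> {-1..1}" using t[OF iq] by auto
        then show ?thesis using iq by (intro exI[of _ i] exI[of _ "y - t i"]) simp
      next
        case False
        define i where "i = nat \<lceil>(y + 1) * q\<rceil>"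
        have "(y + 1) * q \<ge> 0" using y by simp
        then have i: "real i \<ge> (y + 1) * q" "(y + 1) * q > real i - 1"
          unfolding i_def by linarith+
        have "(y + 1) * q \<le> 2 * real q" using y q by (intro mult_right_mono) auto
        with i have "real i < real (2 * q) + 1" by linarith
        then have iq: "i \<le> 2 * q" by linarith
        have "(t i - y) * q = real i - (y + 1) * q"
          using q by (simp add: t_def field_simps)
        with i have "0 \<le> (t i - y) * q" "(t i - y) * q < 1" by linarith+
        with q have h: "0 \<le> t i - y" "(t i - y) * q < 1" by (auto simp: zero_le_mult_iff)
        have "real n * (t i - y) \<le> real q * (t i - y)"
          using q h by (intro mult_right_mono) auto
        then have "real n * (t i - y) \<le> 1" "real n * (t i - y) \<ge> 0" using h by (auto simp: mult.commute)
        moreover have "t i \<ge> 0" using h False by simp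
        moreover have "t i + real n * (y - t i) = t i - real n * (t i - y)" by (simp add: algebra_simps)
        ultimately have "t i + real n * (y - t i) \<in> {-1..1}" using t[OF iq] by auto
        then show ?thesis using iq by (intro exI[of _ i] exI[of _ "y - t i"]) simp
      qed
      then obtain i h where i: "i \<le> 2 * q" and y_eq: "y = t i + h"
        and far: "t i + real n * h \<in> {-1..1}" by blast
      have mem: "t i + real k * h \<in> {-1..1}" if "k \<le> n" for k
      proof -
        have *: "t i + real k * h =
            (1 - real k / real n) *\<^sub>R t i + (real k / real n) *\<^sub>R (t i + real n * h)"
          using \<open>n > 0\<close> by (simp add: field_simps)
        have "t i \<in> {-1..1}" using t[OF i] by auto
        then show ?thesis
          unfolding * using far that \<open>n > 0\<close> by (intro convexD) auto
      qed
      have "\<bar>g (t i + h) - g (t i)\<bar> \<le> M / 2 + C"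
      proof (rule osc)
        fix k assume "k \<le> n"
        then show "\<bar>g (t i + real k * h)\<bar> \<le> M" using mem M by blast
      next
        fix k assume "k + Suc d \<le> n"
        then have "t i + real k * h \<in> {-1..1}" "t i + real (k + Suc d) * h \<in> {-1..1}"
          by (intro mem; simp)+
        then show "\<bar>line_diff (Suc d) h g (t i + real k * h)\<bar> \<le> 1"
          unfolding gdiff by (intro diff) (auto simp: algebra_simps)
      qed
      then show "\<bar>g y\<bar> \<le> M / 2 + (C + E)" using lattice[OF i] y_eq by simp
    qed
    then show "\<exists>c. \<forall>s. \<bar>s\<bar> \<le> 1 \<longrightarrow> \<bar>u s - (\<Sum>k\<le>d. c k * s ^ k)\<bar> \<le> 2 * (C + E)"
      unfolding g_def by (intro exI[of _ c]) (auto simp: abs_le_iff)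
  qed
qed

section \<open>Sums over multi-indices\<close>

text \<open>
  Multi-indices supported in \<open>I\<close>, with each exponent bounded by \<open>d\<close>. They vanish off \<open>I\<close>, so that the same
  function is a multi-index for all larger index sets as well.
\<close>
definition box_indices :: "nat set \<Rightarrow> nat \<Rightarrow> (nat \<Rightarrow> nat) set" where
  "box_indices I d = {\<alpha>. \<forall>i. (i \<in> I \<longrightarrow> \<alpha> i \<in> {..d}) \<and> (i \<notin> I \<longrightarrow> \<alpha> i = 0)}"

definition degree_indices :: "nat set \<Rightarrow> nat \<Rightarrow> (nat \<Rightarrow> nat) set" where
  "degree_indices I d = {\<alpha> \<in> box_indices I d. sum \<alpha> I \<le> d}"

lemma finite_box_indices: "finite I \<Longrightarrow> finite (box_indices I d)"
  unfolding box_indices_def by (intro finite_set_of_finite_funs) auto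

lemma degree_indices_subset: "degree_indices I d \<subseteq> box_indices I d"
  by (auto simp: degree_indices_def)

lemma degree_indices_lessThan: "degree_indices {..<n} d = multi_indices n d"
proof -
  have "\<alpha> i \<le> d" if "sum \<alpha> {..<n} \<le> d" "i < n" for \<alpha> :: "nat \<Rightarrow> nat" and i
    using that member_le_sum[of i "{..<n}" \<alpha>] by force
  then show ?thesis
    by (auto simp: degree_indices_def box_indices_def multi_indices_def not_less)
qed

lemma box_indices_empty: "box_indices {} d = {\<lambda>_. 0}"
  by (auto simp: box_indices_def)

lemma sum_box_indices_insert:
  assumes "finite I" "i \<notin> I"
  shows "(\<Sum>\<alpha>\<in>box_indices (insert i I) d. f \<alpha>) = (\<Sum>\<alpha>\<in>box_indices I d. \<Sum>k\<le>d. f (\<alpha>(i := k)))"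
proof -
  have "(\<Sum>\<alpha>\<in>box_indices I d. \<Sum>k\<le>d. f (\<alpha>(i := k))) =
      (\<Sum>(\<alpha>, k)\<in>box_indices I d \<times> {..d}. f (\<alpha>(i := k)))"
    by (rule sum.cartesian_product)
  also have "\<dots> = (\<Sum>\<alpha>\<in>box_indices (insert i I) d. f \<alpha>)"
    by (rule sum.reindex_bij_witness[where i = "\<lambda>\<gamma>. (\<gamma>(i := 0), \<gamma> i)" and j = "\<lambda>(\<alpha>, k). \<alpha>(i := k)"])
       (use assms in \<open>auto simp: box_indices_def fun_eq_iff\<close>)
  finally show ?thesis by simp
qed

lemma prod_sum_box_indices:
  fixes f :: "nat \<Rightarrow> nat \<Rightarrow> real"
  assumes "finite I"
  shows "(\<Prod>i\<in>I. \<Sum>k\<le>d. f i k) = (\<Sum>\<alpha>\<in>box_indices I d. \<Prod>i\<in>I. f i (\<alpha> i))"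
  using assms
proof (induction I)
  case (insert i I)
  have "(\<Prod>j\<in>I. f j ((\<alpha>(i := k)) j)) = (\<Prod>j\<in>I. f j (\<alpha> j))" for \<alpha> :: "nat \<Rightarrow> nat" and k
    using insert by (intro prod.cong) auto
  then show ?case
    using insert
    by (simp add: sum_box_indices_insert sum_distrib_right sum_distrib_left mult.commute)
qed (simp add: box_indices_empty)

text \<open>
  The multi-indices supported in \<open>A\<close> form a subset of those supported in \<open>I\<close>; this evaluates their share of
  the product expansion over \<open>I\<close>.
\<close>
lemma sum_box_indices_restrict:
  fixes f :: "nat \<Rightarrow> nat \<Rightarrow> real"
  assumes "finite I" "A \<subseteq> I"
  shows "(\<Sum>\<alpha>\<in>box_indices A d. \<Prod>i\<in>I. f i (\<alpha> i)) = (\<Prod>i\<in>A. \<Sum>k\<le>d. f i k) * (\<Prod>i\<in>I - A. f i 0)"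
proof -
  have "(\<Prod>i\<in>I. f i (\<alpha> i)) = (\<Prod>i\<in>A. f i (\<alpha> i)) * (\<Prod>i\<in>I - A. f i 0)" if "\<alpha> \<in> box_indices A d" for \<alpha>
  proof -
    have "(\<Prod>i\<in>I. f i (\<alpha> i)) = (\<Prod>i\<in>I - A. f i (\<alpha> i)) * (\<Prod>i\<in>A. f i (\<alpha> i))"
      by (rule prod.subset_diff) (use assms in auto)
    moreover have "(\<Prod>i\<in>I - A. f i (\<alpha> i)) = (\<Prod>i\<in>I - A. f i 0)"
      by (rule prod.cong) (use that in \<open>auto simp: box_indices_def\<close>)
    ultimately show ?thesis by simp
  qed
  then show ?thesis
    using assms finite_subset
    by (subst prod_sum_box_indices) (auto simp: sum_distrib_right intro!: sum.cong)
qed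

section \<open>Reading off coefficients from values\<close>

definition node_vec :: "(nat \<Rightarrow> real) \<Rightarrow> nat set \<Rightarrow> (nat \<Rightarrow> nat) \<Rightarrow> nat \<Rightarrow> real" where
  "node_vec t T j = (\<lambda>i. if i \<in> T then t (j i) else 0)"

text \<open>
  With \<open>w\<close> the Lagrange weights of the nodes \<open>t\<close>, this is the tensor product of the one-variable functionals
  that read off coefficients: an estimate for the coefficient of the monomial \<open>\<alpha>\<close> which only evaluates \<open>F\<close> at
  vectors supported in \<open>T\<close>.
\<close>
definition coef_at ::
    "(nat \<Rightarrow> nat \<Rightarrow> real) \<Rightarrow> (nat \<Rightarrow> real) \<Rightarrow> nat \<Rightarrow> nat set \<Rightarrow> (nat \<Rightarrow> nat) \<Rightarrow> ((nat \<Rightarrow> real) \<Rightarrow> real) \<Rightarrow> real" where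
  "coef_at w t d T \<alpha> F = (\<Sum>j\<in>box_indices T d. (\<Prod>i\<in>T. w (\<alpha> i) (j i)) * F (node_vec t T j))"

lemma coef_at_diff: "coef_at w t d T \<alpha> (\<lambda>y. F y - G y) = coef_at w t d T \<alpha> F - coef_at w t d T \<alpha> G"
  by (simp add: coef_at_def sum_subtractf[symmetric] algebra_simps)

lemma coef_at_sum:
  "coef_at w t d T \<alpha> (\<lambda>y. \<Sum>\<beta>\<in>A. c \<beta> * F \<beta> y) = (\<Sum>\<beta>\<in>A. c \<beta> * coef_at w t d T \<alpha> (F \<beta>))"
  unfolding coef_at_def sum_distrib_left by (subst sum.swap) (simp add: mult_ac)

lemma coef_at_monomial:
  assumes w: "\<And>i k. i \<le> d \<Longrightarrow> k \<le> d \<Longrightarrow> (\<Sum>j\<le>d. w k j * t j ^ i) = (if i = k then 1 else 0)"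
    and fin: "finite I" "T \<subseteq> I" and \<alpha>: "\<alpha> \<in> box_indices T d" and \<beta>: "\<beta> \<in> box_indices I d"
  shows "coef_at w t d T \<alpha> (\<lambda>y. \<Prod>i\<in>I. y i ^ \<beta> i) = (if \<beta> = \<alpha> then 1 else 0)"
proof -
  have "finite T" using fin finite_subset by blast
  have split: "(\<Prod>i\<in>I. node_vec t T j i ^ \<beta> i) = (\<Prod>i\<in>T. t (j i) ^ \<beta> i) * (\<Prod>i\<in>I - T. 0 ^ \<beta> i)" for j
  proof -
    have "(\<Prod>i\<in>I. node_vec t T j i ^ \<beta> i) =
        (\<Prod>i\<in>I - T. node_vec t T j i ^ \<beta> i) * (\<Prod>i\<in>T. node_vec t T j i ^ \<beta> i)"
      by (rule prod.subset_diff) (use fin in auto)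
    then show ?thesis by (simp add: node_vec_def)
  qed
  have "coef_at w t d T \<alpha> (\<lambda>y. \<Prod>i\<in>I. y i ^ \<beta> i) =
      (\<Sum>j\<in>box_indices T d. \<Prod>i\<in>T. w (\<alpha> i) (j i) * t (j i) ^ \<beta> i) * (\<Prod>i\<in>I - T. 0 ^ \<beta> i)"
    by (simp add: coef_at_def split prod.distrib sum_distrib_right mult.assoc)
  also have "(\<Sum>j\<in>box_indices T d. \<Prod>i\<in>T. w (\<alpha> i) (j i) * t (j i) ^ \<beta> i) =
      (\<Prod>i\<in>T. \<Sum>k\<le>d. w (\<alpha> i) k * t k ^ \<beta> i)"
    by (rule prod_sum_box_indices[symmetric]) fact
  also have "\<dots> = (\<Prod>i\<in>T. if \<beta> i = \<alpha> i then 1 else 0)"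
    by (rule prod.cong) (use w \<alpha> \<beta> fin in \<open>auto simp: box_indices_def\<close>)
  also have "\<dots> * (\<Prod>i\<in>I - T. 0 ^ \<beta> i) = (if \<beta> = \<alpha> then 1 else (0::real))"
  proof (cases "\<beta> = \<alpha>")
    case True
    then have "(\<Prod>i\<in>I - T. (0::real) ^ \<beta> i) = 1"
      using \<alpha> by (intro prod.neutral) (auto simp: box_indices_def)
    with True show ?thesis by simp
  next
    case False
    then obtain i where i: "\<beta> i \<noteq> \<alpha> i" by auto
    have "i \<in> I"
    proof (rule ccontr)
      assume "i \<notin> I"
      then have "\<alpha> i = 0" "\<beta> i = 0" using \<alpha> \<beta> fin by (auto simp: box_indices_def)
      with i show False by simp
    qed
    show ?thesis
    proof (cases "i \<in> T")
      case True
      then have "(\<Prod>i\<in>T. if \<beta> i = \<alpha> i then 1 else 0) = (0::real)"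
        using i \<open>finite T\<close> by (intro prod_zero) auto
      with False show ?thesis by simp
    next
      case not_T: False
      then have "\<beta> i \<noteq> 0" using i \<alpha> by (auto simp: box_indices_def)
      then have "(\<Prod>i\<in>I - T. (0::real) ^ \<beta> i) = 0"
        using not_T \<open>i \<in> I\<close> fin by (intro prod_zero) auto
      with False show ?thesis by simp
    qed
  qed
  finally show ?thesis .
qed

lemma coef_at_polynomial:
  assumes w: "\<And>i k. i \<le> d \<Longrightarrow> k \<le> d \<Longrightarrow> (\<Sum>j\<le>d. w k j * t j ^ i) = (if i = k then 1 else 0)"
    and fin: "finite I" "T \<subseteq> I" and \<alpha>: "\<alpha> \<in> box_indices T d" "\<alpha> \<in> A" and A: "A \<subseteq> box_indices I d"
  shows "coef_at w t d T \<alpha> (\<lambda>y. \<Sum>\<beta>\<in>A. c \<beta> * (\<Prod>i\<in>I. y i ^ \<beta> i)) = c \<alpha>"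
proof -
  have "finite A" using A finite_box_indices[OF fin(1)] finite_subset by blast
  have "coef_at w t d T \<alpha> (\<lambda>y. \<Sum>\<beta>\<in>A. c \<beta> * (\<Prod>i\<in>I. y i ^ \<beta> i)) =
      (\<Sum>\<beta>\<in>A. c \<beta> * (if \<beta> = \<alpha> then 1 else 0))"
    unfolding coef_at_sum
    by (intro sum.cong refl arg_cong2[where f = times] coef_at_monomial[OF w fin \<alpha>(1)]) (use A in auto)
  also have "\<dots> = c \<alpha>"
    using \<open>finite A\<close> \<alpha> by (simp add: if_distrib sum.delta cong: if_cong)
  finally show ?thesis .
qed

text \<open>
  The bound depends on \<open>T\<close> only through its cardinality. For monomials of degree at most \<open>d\<close>, which involve
  at most \<open>d\<close> coordinates, it is therefore independent of the dimension.
\<close>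
lemma coef_at_bound:
  assumes "finite T" "\<alpha> \<in> box_indices T d"
    and F: "\<And>j. j \<in> box_indices T d \<Longrightarrow> \<bar>F (node_vec t T j)\<bar> \<le> M"
  shows "\<bar>coef_at w t d T \<alpha> F\<bar> \<le> (\<Sum>k\<le>d. \<Sum>j\<le>d. \<bar>w k j\<bar>) ^ card T * M"
proof -
  have "(\<lambda>_. 0) \<in> box_indices T d" by (simp add: box_indices_def)
  then have "M \<ge> 0" using F abs_ge_zero order_trans by blast
  have "\<bar>coef_at w t d T \<alpha> F\<bar> \<le> (\<Sum>j\<in>box_indices T d. (\<Prod>i\<in>T. \<bar>w (\<alpha> i) (j i)\<bar>) * M)"
    unfolding coef_at_def
    by (rule order_trans[OF sum_abs sum_mono])
       (auto simp: abs_mult abs_prod intro!: mult_left_mono F prod_nonneg)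
  also have "\<dots> = (\<Prod>i\<in>T. \<Sum>k\<le>d. \<bar>w (\<alpha> i) k\<bar>) * M"
    by (simp add: prod_sum_box_indices[OF \<open>finite T\<close>] sum_distrib_right)
  also have "\<dots> \<le> (\<Prod>i\<in>T. \<Sum>k\<le>d. \<Sum>j\<le>d. \<bar>w k j\<bar>) * M"
  proof (intro mult_right_mono prod_mono conjI \<open>M \<ge> 0\<close> sum_nonneg)
    fix i assume "i \<in> T"
    then have "\<alpha> i \<in> {..d}" using assms by (auto simp: box_indices_def)
    then show "(\<Sum>k\<le>d. \<bar>w (\<alpha> i) k\<bar>) \<le> (\<Sum>k\<le>d. \<Sum>j\<le>d. \<bar>w k j\<bar>)"
      using member_le_sum[of "\<alpha> i" "{..d}" "\<lambda>k. \<Sum>j\<le>d. \<bar>w k j\<bar>"] by (simp add: sum_nonneg)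
  qed auto
  finally show ?thesis by simp
qed

section \<open>A Whitney bound in bounded dimension\<close>

definition lp_on :: "real \<Rightarrow> nat set \<Rightarrow> (nat \<Rightarrow> real) set" where
  "lp_on p I = {y. (\<forall>i. i \<notin> I \<longrightarrow> y i = 0) \<and> (\<Sum>i\<in>I. \<bar>y i\<bar> powr p) \<le> 1}"

lemma lp_on_powr_le:
  assumes "y \<in> lp_on p I" "finite I"
  shows "\<bar>y i\<bar> powr p \<le> 1"
proof (cases "i \<in> I")
  case True
  have "\<bar>y i\<bar> powr p \<le> (\<Sum>i\<in>I. \<bar>y i\<bar> powr p)"
    by (rule member_le_sum) (use True assms in auto)
  then show ?thesis using assms by (simp add: lp_on_def)
next
  case False
  then show ?thesis using assms by (simp add: lp_on_def)
qed

lemma lp_on_abs_le: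
  assumes "y \<in> lp_on p I" "finite I" "p > 0"
  shows "\<bar>y i\<bar> \<le> 1"
proof (rule ccontr)
  assume "\<not> \<bar>y i\<bar> \<le> 1"
  then have "\<bar>y i\<bar> powr p > 1" using \<open>p > 0\<close> by (intro gr_one_powr) auto
  then show False using lp_on_powr_le[OF assms(1,2), of i] by linarith
qed

lemma lp_on_scale:
  assumes "y \<in> lp_on p I" "p > 0" "\<bar>s\<bar> \<le> 1"
  shows "(\<lambda>i. s * y i) \<in> lp_on p I"
proof -
  have "(\<Sum>i\<in>I. \<bar>s * y i\<bar> powr p) \<le> (\<Sum>i\<in>I. \<bar>y i\<bar> powr p)"
    using assms by (intro sum_mono powr_mono2) (auto simp: abs_mult mult_left_le_one_le)
  then show ?thesis using assms by (auto simp: lp_on_def)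
qed

lemma cube_subset_lp_on:
  assumes "\<And>i. i \<notin> I \<Longrightarrow> y i = 0" "\<And>i. i \<in> I \<Longrightarrow> \<bar>y i\<bar> \<le> b" "real (card I) * b powr p \<le> 1" "p > 0"
  shows "y \<in> lp_on p I"
proof -
  have "(\<Sum>i\<in>I. \<bar>y i\<bar> powr p) \<le> (\<Sum>i\<in>I. b powr p)"
    using assms by (intro sum_mono powr_mono2) auto
  then show ?thesis using assms by (auto simp: lp_on_def)
qed

text \<open>
  The hypotheses under which polynomial approximation is proved. Boundedness is qualitative: no constant of
  approximation depends on \<open>B\<close>.
\<close>
definition tame :: "real \<Rightarrow> nat \<Rightarrow> nat set \<Rightarrow> ((nat \<Rightarrow> real) \<Rightarrow> real) \<Rightarrow> bool" where
  "tame p m I F \<longleftrightarrow> (\<exists>B. \<forall>y\<in>lp_on p I. \<bar>F y\<bar> \<le> B) \<and>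
     (\<forall>x h. (\<forall>j\<le>m. shift x h j \<in> lp_on p I) \<longrightarrow> \<bar>fin_diff m h F x\<bar> \<le> 1)"

lemma fin_diff_line:
  "fin_diff m (\<lambda>i. h * v i) F (\<lambda>i. z i + x * v i) = line_diff m h (\<lambda>s. F (\<lambda>i. z i + s * v i)) x"
  by (simp add: fin_diff_def line_diff_def shift_def algebra_simps)

text \<open>
  The one-variable theorem on a segment through \<open>z\<close> in direction \<open>v\<close>, with a constant that depends neither on
  the length of the segment nor on the dimension.
\<close>
lemma whitney_segment:
  fixes p :: real
  obtains W :: real where "W \<ge> 0"
    "\<And>I F z v b. tame p (Suc d) I F \<Longrightarrow> b > 0 \<Longrightarrow>
      (\<And>s. \<bar>s\<bar> \<le> b \<Longrightarrow> (\<lambda>i. z i + s * v i) \<in> lp_on p I) \<Longrightarrow>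
      \<exists>c. \<forall>s. \<bar>s\<bar> \<le> b \<longrightarrow> \<bar>F (\<lambda>i. z i + s * v i) - (\<Sum>k\<le>d. c k * s ^ k)\<bar> \<le> W"
proof -
  obtain W where "W \<ge> 0" and W:
    "\<And>u B. (\<And>s. \<bar>s\<bar> \<le> 1 \<Longrightarrow> \<bar>u s\<bar> \<le> B) \<Longrightarrow>
      (\<And>x h. \<bar>x\<bar> \<le> 1 \<Longrightarrow> \<bar>x + real (Suc d) * h\<bar> \<le> 1 \<Longrightarrow> \<bar>line_diff (Suc d) h u x\<bar> \<le> 1) \<Longrightarrow>
      \<exists>c. \<forall>s. \<bar>s\<bar> \<le> 1 \<longrightarrow> \<bar>u s - (\<Sum>k\<le>d. c k * s ^ k)\<bar> \<le> W"
    using whitney_interval[of d thesis] by blast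
  show thesis
  proof (rule that[OF \<open>W \<ge> 0\<close>])
    fix I F and z v :: "nat \<Rightarrow> real" and b :: real
    assume F: "tame p (Suc d) I F" and "b > 0"
      and dom: "\<And>s. \<bar>s\<bar> \<le> b \<Longrightarrow> (\<lambda>i. z i + s * v i) \<in> lp_on p I"
    from F obtain B where B: "\<And>y. y \<in> lp_on p I \<Longrightarrow> \<bar>F y\<bar> \<le> B" by (auto simp: tame_def)
    define u where "u s = F (\<lambda>i. z i + s * (b * v i))" for s
    have dom': "(\<lambda>i. z i + s * (b * v i)) \<in> lp_on p I" if "\<bar>s\<bar> \<le> 1" for s
      using dom[of "s * b"] that \<open>b > 0\<close> by (simp add: abs_mult mult.assoc)
    have "\<exists>c. \<forall>s. \<bar>s\<bar> \<le> 1 \<longrightarrow> \<bar>u s - (\<Sum>k\<le>d. c k * s ^ k)\<bar> \<le> W"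
    proof (rule W)
      fix s :: real assume "\<bar>s\<bar> \<le> 1"
      then show "\<bar>u s\<bar> \<le> B" unfolding u_def by (intro B dom')
    next
      fix x h :: real assume x: "\<bar>x\<bar> \<le> 1" "\<bar>x + real (Suc d) * h\<bar> \<le> 1"
      have "\<bar>x + real j * h\<bar> \<le> 1" if "j \<le> Suc d" for j
      proof -
        have *: "x + real j * h = (1 - real j / real (Suc d)) *\<^sub>R x +
            (real j / real (Suc d)) *\<^sub>R (x + real (Suc d) * h)"
          by (simp add: field_simps del: of_nat_Suc)
        have "x + real j * h \<in> {-1..1}"
          unfolding * using x that by (intro convexD) (auto simp: abs_le_iff)
        then show ?thesis by auto
      qed
      note mem = dom'[OF this]
      have sh: "shift (\<lambda>i. z i + x * (b * v i)) (\<lambda>i. h * (b * v i)) j =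
          (\<lambda>i. z i + (x + real j * h) * (b * v i))" for j
        by (simp add: shift_def algebra_simps)
      have "\<forall>j\<le>Suc d. shift (\<lambda>i. z i + x * (b * v i)) (\<lambda>i. h * (b * v i)) j \<in> lp_on p I"
        unfolding sh using mem by blast
      then have "\<bar>fin_diff (Suc d) (\<lambda>i. h * (b * v i)) F (\<lambda>i. z i + x * (b * v i))\<bar> \<le> 1"
        using F by (simp add: tame_def)
      also have "fin_diff (Suc d) (\<lambda>i. h * (b * v i)) F (\<lambda>i. z i + x * (b * v i)) =
          line_diff (Suc d) h u x"
        unfolding u_def by (rule fin_diff_line)
      finally show "\<bar>line_diff (Suc d) h u x\<bar> \<le> 1" .
    qed
    then obtain c where c: "\<And>s. \<bar>s\<bar> \<le> 1 \<Longrightarrow> \<bar>u s - (\<Sum>k\<le>d. c k * s ^ k)\<bar> \<le> W" by blast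
    have "\<bar>F (\<lambda>i. z i + s * v i) - (\<Sum>k\<le>d. (c k / b ^ k) * s ^ k)\<bar> \<le> W" if "\<bar>s\<bar> \<le> b" for s
    proof -
      have "\<bar>s / b\<bar> \<le> 1" using that \<open>b > 0\<close> by simp
      from c[OF this] show ?thesis using \<open>b > 0\<close> by (simp add: u_def power_divide)
    qed
    then show "\<exists>c. \<forall>s. \<bar>s\<bar> \<le> b \<longrightarrow> \<bar>F (\<lambda>i. z i + s * v i) - (\<Sum>k\<le>d. c k * s ^ k)\<bar> \<le> W"
      by (intro exI[of _ "\<lambda>k. c k / b ^ k"] allI impI)
  qed
qed

text \<open>
  Interpolating one coordinate after the other replaces \<open>F\<close> by its tensor product interpolant. Each of the
  steps adds the one-variable error \<open>W\<close>, magnified by the interpolation norm \<open>\<Lambda>\<close> once for every coordinate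
  that has been dealt with already.
\<close>
lemma tensor_interpolation_error:
  fixes l :: "nat \<Rightarrow> real \<Rightarrow> real"
  assumes "finite T"
    and dom: "\<And>y i k. y \<in> S \<Longrightarrow> i \<in> T \<Longrightarrow> k \<le> d \<Longrightarrow> y(i := t k) \<in> S"
    and err: "\<And>y i. y \<in> S \<Longrightarrow> i \<in> T \<Longrightarrow> \<bar>F y - (\<Sum>k\<le>d. l k (y i) * F (y(i := t k)))\<bar> \<le> W"
    and leb: "\<And>y i. y \<in> S \<Longrightarrow> i \<in> T \<Longrightarrow> (\<Sum>k\<le>d. \<bar>l k (y i)\<bar>) \<le> \<Lambda>"
    and "y \<in> S"
  shows "\<bar>F y - (\<Sum>j\<in>box_indices T d. (\<Prod>i\<in>T. l (j i) (y i)) * F (\<lambda>i. if i \<in> T then t (j i) else y i))\<bar>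
    \<le> W * (\<Sum>k<card T. \<Lambda> ^ k)"
  using \<open>finite T\<close> dom err leb
proof (induction T)
  case empty
  then show ?case by (simp add: box_indices_empty)
next
  case (insert i T)
  define z where "z j = (\<lambda>i. if i \<in> T then t (j i) else y i)" for j :: "nat \<Rightarrow> nat"
  have z: "z j \<in> S" if "j \<in> box_indices T d" for j
  proof -
    have "(\<lambda>i. if i \<in> A then t (j i) else y i) \<in> S" if "finite A" "A \<subseteq> T" for A
      using that
    proof (induction A)
      case (insert a A)
      have "(\<lambda>i. if i \<in> insert a A then t (j i) else y i) =
          (\<lambda>i. if i \<in> A then t (j i) else y i)(a := t (j a))" by auto
      moreover have "\<dots> \<in> S"
        using insert insert.prems \<open>j \<in> box_indices T d\<close>
        by (intro \<open>\<And>y i' k. y \<in> S \<Longrightarrow> i' \<in> insert i T \<Longrightarrow> k \<le> d \<Longrightarrow> y(i' := t k) \<in> S\<close>)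
           (auto simp: box_indices_def)
      ultimately show ?case by simp
    qed (use \<open>y \<in> S\<close> in simp)
    from this[OF \<open>finite T\<close>] show ?thesis by (simp add: z_def)
  qed
  have zi: "z j i = y i" for j using insert.hyps by (simp add: z_def)
  have W: "W \<ge> 0" using insert.prems(2)[OF \<open>y \<in> S\<close>, of i] abs_ge_zero order_trans by blast
  let ?Q = "\<Sum>j\<in>box_indices T d. (\<Prod>i\<in>T. l (j i) (y i)) * F (z j)"
  let ?R = "\<Sum>j\<in>box_indices T d. (\<Prod>i\<in>T. l (j i) (y i)) * (\<Sum>k\<le>d. l k (y i) * F ((z j)(i := t k)))"
  have "(\<Sum>j\<in>box_indices (insert i T) d. (\<Prod>i\<in>insert i T. l (j i) (y i)) *
      F (\<lambda>i'. if i' \<in> insert i T then t (j i') else y i')) = ?R"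
    unfolding sum_box_indices_insert[OF insert.hyps(1,2)] sum_distrib_left
  proof (intro sum.cong refl)
    fix j k
    have "(\<Prod>i'\<in>insert i T. l ((j(i := k)) i') (y i')) = l k (y i) * (\<Prod>i\<in>T. l (j i) (y i))"
      using insert.hyps by (auto intro!: prod.cong)
    moreover have "(\<lambda>i'. if i' \<in> insert i T then t ((j(i := k)) i') else y i') = (z j)(i := t k)"
      using insert.hyps by (auto simp: z_def)
    ultimately show "(\<Prod>i'\<in>insert i T. l ((j(i := k)) i') (y i')) *
        F (\<lambda>i'. if i' \<in> insert i T then t ((j(i := k)) i') else y i') =
        (\<Prod>i\<in>T. l (j i) (y i)) * (l k (y i) * F ((z j)(i := t k)))"
      by simp
  qed
  moreover have "\<bar>F y - ?Q\<bar> \<le> W * (\<Sum>k<card T. \<Lambda> ^ k)"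
    using insert.IH insert.prems unfolding z_def by blast
  moreover have "\<bar>?Q - ?R\<bar> \<le> W * \<Lambda> ^ card T"
  proof -
    have "?Q - ?R = (\<Sum>j\<in>box_indices T d. (\<Prod>i\<in>T. l (j i) (y i)) *
        (F (z j) - (\<Sum>k\<le>d. l k (y i) * F ((z j)(i := t k)))))"
      by (simp add: sum_subtractf[symmetric] algebra_simps)
    also have "\<bar>\<dots>\<bar> \<le> (\<Sum>j\<in>box_indices T d. (\<Prod>i\<in>T. \<bar>l (j i) (y i)\<bar>) * W)"
    proof (rule order_trans[OF sum_abs sum_mono])
      fix j assume j: "j \<in> box_indices T d"
      have "\<bar>F (z j) - (\<Sum>k\<le>d. l k (y i) * F ((z j)(i := t k)))\<bar> \<le> W"
        using insert.prems(2)[OF z[OF j] insertI1] unfolding zi .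
      then show "\<bar>(\<Prod>i\<in>T. l (j i) (y i)) * (F (z j) - (\<Sum>k\<le>d. l k (y i) * F ((z j)(i := t k))))\<bar> \<le>
          (\<Prod>i\<in>T. \<bar>l (j i) (y i)\<bar>) * W"
        unfolding abs_mult abs_prod by (intro mult_left_mono prod_nonneg) auto
    qed
    also have "\<dots> = W * (\<Prod>i\<in>T. \<Sum>k\<le>d. \<bar>l k (y i)\<bar>)"
      by (simp add: prod_sum_box_indices[OF insert.hyps(1)] sum_distrib_left mult.commute)
    also have "\<dots> \<le> W * (\<Prod>i\<in>T. \<Lambda>)"
      using insert.prems(3)[OF \<open>y \<in> S\<close>] W by (intro mult_left_mono prod_mono) (auto simp: sum_nonneg)
    finally show ?thesis by simp
  qed
  ultimately show ?case
    using insert.hyps by (simp add: distrib_left)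
qed

text \<open>
  On a small cube inside the ball, tensor product interpolation approximates \<open>F\<close> by a polynomial \<open>Q\<close> of
  degree at most \<open>d\<close> in each coordinate; its total degree may be too large. Along each ray from the origin,
  \<open>F\<close> is close to a polynomial of degree at most \<open>d\<close> by the one-variable theorem, and near the origin this
  polynomial is close to \<open>Q\<close>. Hence their coefficients are close to each other, and the homogeneous parts of \<open>Q\<close>
  of degree at most \<open>d\<close> approximate \<open>F\<close> on the entire ray.
\<close>
lemma whitney_bounded_dimension:
  fixes p :: real
  assumes "p > 0"
  obtains W :: real where "W \<ge> 0"
    "\<And>I F. finite I \<Longrightarrow> card I \<le> N \<Longrightarrow> tame p (Suc d) I F \<Longrightarrow>
      \<exists>c. \<forall>y\<in>lp_on p I. \<bar>F y - (\<Sum>\<alpha>\<in>degree_indices I d. c \<alpha> * (\<Prod>i\<in>I. y i ^ \<alpha> i))\<bar> \<le> W"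
proof -
  obtain W where "W \<ge> 0" and W:
    "\<And>I F z v b. tame p (Suc d) I F \<Longrightarrow> b > 0 \<Longrightarrow>
      (\<And>s. \<bar>s\<bar> \<le> b \<Longrightarrow> (\<lambda>i. z i + s * v i) \<in> lp_on p I) \<Longrightarrow>
      \<exists>c. \<forall>s. \<bar>s\<bar> \<le> b \<longrightarrow> \<bar>F (\<lambda>i. z i + s * v i) - (\<Sum>k\<le>d. c k * s ^ k)\<bar> \<le> W"
    by (fact whitney_segment[of p d thesis])
  define b where "b = (1 / real (Suc N)) powr (1 / p)"
  have b: "b > 0" by (simp add: b_def)
  \<comment> \<open>The side of the cube is chosen such that the cube lies in the ball in every dimension up to \<open>N\<close>.\<close>
  have "b powr p = 1 / real (Suc N)"
    using \<open>p > 0\<close> by (simp add: b_def powr_powr)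
  then have Nb: "real n * b powr p \<le> 1" if "n \<le> N" for n
    using that by simp
  have b1: "b \<le> 1" unfolding b_def by (rule powr_le1) (use \<open>p > 0\<close> in auto)
  define t where "t j = b * real j / real (Suc d)" for j
  have t: "\<bar>t j\<bar> \<le> b" if "j \<le> d" for j
  proof -
    have "b * real j \<le> b * real (Suc d)" using b that by (intro mult_left_mono) auto
    then show ?thesis using b by (simp add: t_def abs_mult field_simps)
  qed
  have "inj_on t {..d}" using b by (auto simp: inj_on_def t_def)
  then obtain w where w: "\<And>i k. i \<le> d \<Longrightarrow> k \<le> d \<Longrightarrow> (\<Sum>j\<le>d. w k j * t j ^ i) = (if i = k then 1 else 0)"
    using lagrange_weights by metis
  define \<Lambda> where "\<Lambda> = (\<Sum>k\<le>d. \<Sum>j\<le>d. \<bar>w k j\<bar>)"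
  have "\<Lambda> \<ge> 0" by (simp add: \<Lambda>_def sum_nonneg)
  define l where "l j s = (\<Sum>k\<le>d. w k j * s ^ k)" for j s
  have l_le: "(\<Sum>j\<le>d. \<bar>l j s\<bar>) \<le> \<Lambda>" if "\<bar>s\<bar> \<le> 1" for s
  proof -
    have "(\<Sum>j\<le>d. \<bar>l j s\<bar>) \<le> (\<Sum>j\<le>d. \<Sum>k\<le>d. \<bar>w k j\<bar>)"
      unfolding l_def
      by (intro sum_mono order_trans[OF sum_abs])
         (use that in \<open>auto simp: abs_mult power_abs intro!: mult_left_le power_le_one\<close>)
    also have "\<dots> = \<Lambda>" unfolding \<Lambda>_def by (rule sum.swap)
    finally show ?thesis .
  qed
  have l_poly: "(\<Sum>j\<le>d. l j s * (\<Sum>i\<le>d. c i * t j ^ i)) = (\<Sum>k\<le>d. c k * s ^ k)" for c s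
  proof -
    have "(\<Sum>j\<le>d. l j s * (\<Sum>i\<le>d. c i * t j ^ i)) =
        (\<Sum>k\<le>d. (\<Sum>j\<le>d. w k j * (\<Sum>i\<le>d. c i * t j ^ i)) * s ^ k)"
      unfolding l_def sum_distrib_right by (subst sum.swap) (simp add: mult_ac)
    also have "\<dots> = (\<Sum>k\<le>d. c k * s ^ k)"
      by (intro sum.cong refl) (simp add: weights_extract_coeff[OF w])
    finally show ?thesis .
  qed
  \<comment> \<open>A bound for the degrees of both polynomials compared along a ray, including the case \<open>N = 0\<close>.\<close>
  define D where "D = N * d + d"
  define t' where "t' j = b * real j / real (Suc D)" for j
  have t': "\<bar>t' j\<bar> \<le> b" if "j \<le> D" for j
  proof -
    have "b * real j \<le> b * real (Suc D)" using b that by (intro mult_left_mono) auto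
    then show ?thesis using b by (simp add: t'_def abs_mult field_simps)
  qed
  have "inj_on t' {..D}" using b by (auto simp: inj_on_def t'_def)
  then obtain w' where w': "\<And>i k. i \<le> D \<Longrightarrow> k \<le> D \<Longrightarrow> (\<Sum>j\<le>D. w' k j * t' j ^ i) = (if i = k then 1 else 0)"
    using lagrange_weights by metis
  define \<Lambda>' where "\<Lambda>' = (\<Sum>k\<le>D. \<Sum>j\<le>D. \<bar>w' k j\<bar>)"
  have "\<Lambda>' \<ge> 0" by (simp add: \<Lambda>'_def sum_nonneg)
  define C where "C = (W + \<Lambda> * W) * (\<Sum>k<N. \<Lambda> ^ k)"
  have "C \<ge> 0" using \<open>W \<ge> 0\<close> \<open>\<Lambda> \<ge> 0\<close> by (simp add: C_def sum_nonneg)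
  show thesis
  proof (rule that[of "W + \<Lambda>' * (W + C)"])
    show "W + \<Lambda>' * (W + C) \<ge> 0" using \<open>W \<ge> 0\<close> \<open>\<Lambda>' \<ge> 0\<close> \<open>C \<ge> 0\<close> by simp
    fix I F assume I: "finite I" "card I \<le> N" and F: "tame p (Suc d) I F"
    define S where "S = {y :: nat \<Rightarrow> real. (\<forall>i. i \<notin> I \<longrightarrow> y i = 0) \<and> (\<forall>i\<in>I. \<bar>y i\<bar> \<le> b)}"
    have S_lp: "y \<in> lp_on p I" if "y \<in> S" for y
      using cube_subset_lp_on[of I y b p] that Nb[OF I(2)] \<open>p > 0\<close> by (auto simp: S_def)
    have upd: "y(i := s) \<in> S" if "y \<in> S" "i \<in> I" "\<bar>s\<bar> \<le> b" for y i s
      using that by (auto simp: S_def)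
    have err: "\<bar>F y - (\<Sum>j\<le>d. l j (y i) * F (y(i := t j)))\<bar> \<le> W + \<Lambda> * W" if y: "y \<in> S" "i \<in> I" for y i
    proof -
      have line: "(\<lambda>i'. (y(i := 0)) i' + s * (if i' = i then 1 else 0)) = y(i := s)" for s
        by auto
      have "\<exists>c. \<forall>s. \<bar>s\<bar> \<le> b \<longrightarrow>
          \<bar>F (\<lambda>i'. (y(i := 0)) i' + s * (if i' = i then 1 else 0)) - (\<Sum>k\<le>d. c k * s ^ k)\<bar> \<le> W"
        by (rule W[OF F \<open>b > 0\<close>]) (unfold line, intro S_lp upd y)
      then obtain c where c: "\<And>s. \<bar>s\<bar> \<le> b \<Longrightarrow> \<bar>F (y(i := s)) - (\<Sum>k\<le>d. c k * s ^ k)\<bar> \<le> W"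
        unfolding line by blast
      have yi: "\<bar>y i\<bar> \<le> b" using y by (simp add: S_def)
      have "\<bar>(\<Sum>k\<le>d. c k * y i ^ k) - (\<Sum>j\<le>d. l j (y i) * F (y(i := t j)))\<bar> =
          \<bar>\<Sum>j\<le>d. l j (y i) * ((\<Sum>k\<le>d. c k * t j ^ k) - F (y(i := t j)))\<bar>"
        unfolding l_poly[where c = c and s = "y i", symmetric] by (simp add: sum_subtractf[symmetric] right_diff_distrib)
      also have "\<dots> \<le> (\<Sum>j\<le>d. \<bar>l j (y i)\<bar> * W)"
        by (rule order_trans[OF sum_abs sum_mono])
           (use c t in \<open>auto simp: abs_mult abs_minus_commute intro!: mult_left_mono\<close>)
      also have "\<dots> \<le> \<Lambda> * W"
        unfolding sum_distrib_right[symmetric] using l_le[of "y i"] yi b1 \<open>W \<ge> 0\<close>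
        by (intro mult_right_mono) auto
      finally show ?thesis using c[OF yi] by simp
    qed
    define q where "q \<kappa> = coef_at w t d I \<kappa> F" for \<kappa>
    define Q where "Q y = (\<Sum>\<kappa>\<in>box_indices I d. q \<kappa> * (\<Prod>i\<in>I. y i ^ \<kappa> i))" for y
    have Q_eq: "Q y = (\<Sum>j\<in>box_indices I d. (\<Prod>i\<in>I. l (j i) (y i)) * F (node_vec t I j))" for y
    proof -
      have "(\<Prod>i\<in>I. l (j i) (y i)) = (\<Sum>\<kappa>\<in>box_indices I d. \<Prod>i\<in>I. w (\<kappa> i) (j i) * y i ^ \<kappa> i)" for j
        unfolding l_def by (rule prod_sum_box_indices[OF I(1)])
      note l_prod = this
      have "Q y = (\<Sum>\<kappa>\<in>box_indices I d. \<Sum>j\<in>box_indices I d.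
          (\<Prod>i\<in>I. w (\<kappa> i) (j i) * y i ^ \<kappa> i) * F (node_vec t I j))"
        by (simp add: Q_def q_def coef_at_def sum_distrib_left sum_distrib_right prod.distrib mult_ac)
      also have "\<dots> = (\<Sum>j\<in>box_indices I d. \<Sum>\<kappa>\<in>box_indices I d.
          (\<Prod>i\<in>I. w (\<kappa> i) (j i) * y i ^ \<kappa> i) * F (node_vec t I j))"
        by (rule sum.swap)
      finally show ?thesis by (simp only: l_prod sum_distrib_right)
    qed
    have Q: "\<bar>F y - Q y\<bar> \<le> C" if "y \<in> S" for y
    proof -
      have nodes: "(\<lambda>i. if i \<in> I then t (j i) else y i) = node_vec t I j" for j
        using that by (auto simp: node_vec_def S_def)
      have "\<bar>F y - (\<Sum>j\<in>box_indices I d. (\<Prod>i\<in>I. l (j i) (y i)) *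
          F (\<lambda>i. if i \<in> I then t (j i) else y i))\<bar> \<le> (W + \<Lambda> * W) * (\<Sum>k<card I. \<Lambda> ^ k)"
      proof (rule tensor_interpolation_error[where S = S])
        fix y i assume "y \<in> S" "i \<in> I"
        then have "\<bar>y i\<bar> \<le> 1" using b1 by (force simp: S_def)
        then show "(\<Sum>k\<le>d. \<bar>l k (y i)\<bar>) \<le> \<Lambda>" by (rule l_le)
        show "\<bar>F y - (\<Sum>k\<le>d. l k (y i) * F (y(i := t k)))\<bar> \<le> W + \<Lambda> * W"
          by (rule err) fact+
        show "y(i := t k) \<in> S" if "k \<le> d" for k
          by (intro upd t that) fact+
      qed (use I that in auto)
      also have "(W + \<Lambda> * W) * (\<Sum>k<card I. \<Lambda> ^ k) \<le> C"
        unfolding C_def using I \<open>\<Lambda> \<ge> 0\<close> \<open>W \<ge> 0\<close> by (intro mult_left_mono sum_mono2) auto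
      finally show ?thesis by (simp only: Q_eq nodes)
    qed
    have "\<bar>F x - (\<Sum>\<alpha>\<in>degree_indices I d. q \<alpha> * (\<Prod>i\<in>I. x i ^ \<alpha> i))\<bar> \<le> W + \<Lambda>' * (W + C)"
      if x: "x \<in> lp_on p I" for x
    proof -
      have "\<exists>c. \<forall>s. \<bar>s\<bar> \<le> 1 \<longrightarrow> \<bar>F (\<lambda>i. 0 + s * x i) - (\<Sum>k\<le>d. c k * s ^ k)\<bar> \<le> W"
        by (rule W[OF F]) (use lp_on_scale[OF x \<open>p > 0\<close>] in auto)
      then obtain c where c: "\<And>s. \<bar>s\<bar> \<le> 1 \<Longrightarrow> \<bar>F (\<lambda>i. s * x i) - (\<Sum>k\<le>d. c k * s ^ k)\<bar> \<le> W"
        by auto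
      \<comment> \<open>The homogeneous part of degree \<open>k\<close> of \<open>Q\<close>, evaluated at \<open>x\<close>.\<close>
      define R where "R k = (\<Sum>\<kappa> | \<kappa> \<in> box_indices I d \<and> sum \<kappa> I = k. q \<kappa> * (\<Prod>i\<in>I. x i ^ \<kappa> i))" for k
      have fin: "finite (box_indices I d)" by (rule finite_box_indices) fact
      have deg: "sum \<kappa> I \<le> D" if "\<kappa> \<in> box_indices I d" for \<kappa>
      proof -
        have "sum \<kappa> I \<le> card I * d"
          using sum_bounded_above[of I \<kappa> d] that by (auto simp: box_indices_def)
        also have "\<dots> \<le> N * d" using I by simp
        finally show ?thesis by (simp add: D_def)
      qed
      have Q_ray: "Q (\<lambda>i. s * x i) = (\<Sum>k\<le>D. R k * s ^ k)" for s
      proof -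
        have "Q (\<lambda>i. s * x i) = (\<Sum>\<kappa>\<in>box_indices I d. q \<kappa> * (\<Prod>i\<in>I. x i ^ \<kappa> i) * s ^ sum \<kappa> I)"
          by (simp add: Q_def power_mult_distrib prod.distrib power_sum mult_ac)
        also have "\<dots> = (\<Sum>k\<le>D. \<Sum>\<kappa> | \<kappa> \<in> box_indices I d \<and> sum \<kappa> I = k.
            q \<kappa> * (\<Prod>i\<in>I. x i ^ \<kappa> i) * s ^ sum \<kappa> I)"
          by (rule sum.group[symmetric]) (use fin deg in auto)
        also have "\<dots> = (\<Sum>k\<le>D. R k * s ^ k)"
          by (simp add: R_def sum_distrib_right)
        finally show ?thesis .
      qed
      define e where "e k = (if k \<le> d then c k else 0) - R k" for k
      have "d \<le> D" by (simp add: D_def)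
      have e_sum: "(\<Sum>k\<le>D. e k * s ^ k) = (\<Sum>k\<le>d. c k * s ^ k) - Q (\<lambda>i. s * x i)" for s
      proof -
        have "(\<Sum>k\<le>D. (if k \<le> d then c k else 0) * s ^ k) = (\<Sum>k\<le>d. c k * s ^ k)"
          by (rule sum.mono_neutral_cong_right) (use \<open>d \<le> D\<close> in auto)
        then show ?thesis by (simp add: e_def Q_ray left_diff_distrib sum_subtractf)
      qed
      have e_val: "\<bar>\<Sum>k\<le>D. e k * s ^ k\<bar> \<le> W + C" if "\<bar>s\<bar> \<le> b" for s
      proof -
        have "\<bar>s * x i\<bar> \<le> b" for i
          using that mult_mono[OF that lp_on_abs_le[OF x I(1) \<open>p > 0\<close>, of i]] b by (simp add: abs_mult)
        then have "(\<lambda>i. s * x i) \<in> S" using x by (auto simp: S_def lp_on_def)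
        from Q[OF this] c[of s] that b1 show ?thesis unfolding e_sum by linarith
      qed
      have e_le: "\<bar>e k\<bar> \<le> (\<Sum>j\<le>D. \<bar>w' k j\<bar>) * (W + C)" if "k \<le> D" for k
      proof -
        have "e k = (\<Sum>j\<le>D. w' k j * (\<Sum>i\<le>D. e i * t' j ^ i))"
          by (rule weights_extract_coeff[OF w' that, symmetric])
        also have "\<bar>\<dots>\<bar> \<le> (\<Sum>j\<le>D. \<bar>w' k j\<bar> * (W + C))"
          by (rule order_trans[OF sum_abs sum_mono])
             (use e_val t' in \<open>auto simp: abs_mult intro!: mult_left_mono\<close>)
        finally show ?thesis by (simp add: sum_distrib_right)
      qed
      have "\<bar>\<Sum>k\<le>d. e k\<bar> \<le> (\<Sum>k\<le>d. (\<Sum>j\<le>D. \<bar>w' k j\<bar>) * (W + C))"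
        by (rule order_trans[OF sum_abs sum_mono]) (use e_le \<open>d \<le> D\<close> in auto)
      also have "\<dots> \<le> (\<Sum>k\<le>D. (\<Sum>j\<le>D. \<bar>w' k j\<bar>) * (W + C))"
        using \<open>d \<le> D\<close> \<open>W \<ge> 0\<close> \<open>C \<ge> 0\<close>
        by (intro sum_mono2) (auto intro!: mult_nonneg_nonneg sum_nonneg)
      also have "\<dots> = \<Lambda>' * (W + C)"
        unfolding \<Lambda>'_def by (rule sum_distrib_right[symmetric])
      finally have "\<bar>\<Sum>k\<le>d. e k\<bar> \<le> \<Lambda>' * (W + C)" .
      moreover have "(\<Sum>k\<le>d. e k) = (\<Sum>k\<le>d. c k) - (\<Sum>k\<le>d. R k)"
        by (simp add: e_def sum_subtractf)
      moreover have "(\<Sum>k\<le>d. R k) = (\<Sum>\<alpha>\<in>degree_indices I d. q \<alpha> * (\<Prod>i\<in>I. x i ^ \<alpha> i))"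
      proof -
        have "(\<Sum>k\<le>d. \<Sum>\<kappa> | \<kappa> \<in> degree_indices I d \<and> sum \<kappa> I = k. q \<kappa> * (\<Prod>i\<in>I. x i ^ \<kappa> i)) =
            (\<Sum>\<alpha>\<in>degree_indices I d. q \<alpha> * (\<Prod>i\<in>I. x i ^ \<alpha> i))"
          by (rule sum.group)
             (use fin finite_subset[OF degree_indices_subset] in \<open>auto simp: degree_indices_def\<close>)
        moreover have "{\<kappa> \<in> degree_indices I d. sum \<kappa> I = k} = {\<kappa> \<in> box_indices I d. sum \<kappa> I = k}"
          if "k \<le> d" for k
          using that by (auto simp: degree_indices_def)
        ultimately show ?thesis by (simp add: R_def)
      qed
      moreover have "\<bar>F x - (\<Sum>k\<le>d. c k)\<bar> \<le> W" using c[of 1] by simp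
      ultimately show ?thesis by linarith
    qed
    then show "\<exists>c. \<forall>y\<in>lp_on p I. \<bar>F y - (\<Sum>\<alpha>\<in>degree_indices I d. c \<alpha> * (\<Prod>i\<in>I. y i ^ \<alpha> i))\<bar> \<le>
        W + \<Lambda>' * (W + C)"
      by (intro exI[of _ q] ballI)
  qed
qed

section \<open>The sparse interpolant\<close>

lemma fin_diff_monomial:
  assumes "finite I" "\<alpha> \<in> degree_indices I d"
  shows "fin_diff (Suc d) h (\<lambda>y. \<Prod>i\<in>I. y i ^ \<alpha> i) x = 0"
proof -
  define P where "P = (\<Prod>i\<in>I. [:x i, h i:] ^ \<alpha> i)"
  have "degree P \<le> (\<Sum>i\<in>I. degree ([:x i, h i:] ^ \<alpha> i))"
    unfolding P_def using degree_prod_sum_le[OF assms(1)] by (simp add: o_def)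
  also have "\<dots> \<le> (\<Sum>i\<in>I. \<alpha> i)"
    by (intro sum_mono order_trans[OF degree_power_le]) simp
  also have "\<dots> \<le> d" using assms by (simp add: degree_indices_def)
  finally have "degree P \<le> d" .
  have P: "(\<Prod>i\<in>I. (x i + s * h i) ^ \<alpha> i) = (\<Sum>k\<le>d. coeff P k * s ^ k)" for s
  proof -
    have "(\<Prod>i\<in>I. (x i + s * h i) ^ \<alpha> i) = poly P s"
      by (simp add: P_def poly_prod mult.commute)
    also have "\<dots> = (\<Sum>k\<le>degree P. coeff P k * s ^ k)" by (rule poly_altdef)
    also have "\<dots> = (\<Sum>k\<le>d. coeff P k * s ^ k)"
      by (rule sum.mono_neutral_left) (use \<open>degree P \<le> d\<close> in \<open>auto simp: le_degree\<close>)
    finally show ?thesis .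
  qed
  have "fin_diff (Suc d) h (\<lambda>y. \<Prod>i\<in>I. y i ^ \<alpha> i) x =
      line_diff (Suc d) 1 (\<lambda>s. \<Sum>k\<le>d. coeff P k * s ^ k) 0"
    unfolding P[symmetric] by (simp add: fin_diff_def line_diff_def shift_def)
  also have "\<dots> = 0" by (rule line_diff_poly) simp
  finally show ?thesis .
qed

lemma fin_diff_minus: "fin_diff m h (\<lambda>y. F y - G y) x = fin_diff m h F x - fin_diff m h G x"
  by (simp add: fin_diff_def sum_subtractf[symmetric] right_diff_distrib)

lemma fin_diff_sum:
  "fin_diff m h (\<lambda>y. \<Sum>\<alpha>\<in>A. c \<alpha> * F \<alpha> y) x = (\<Sum>\<alpha>\<in>A. c \<alpha> * fin_diff m h (F \<alpha>) x)"
  unfolding fin_diff_def sum_distrib_left by (subst sum.swap) (simp add: mult_ac)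

definition support :: "(nat \<Rightarrow> nat) \<Rightarrow> nat set" where
  "support \<alpha> = {i. \<alpha> i \<noteq> 0}"

lemma degree_indices_support:
  assumes "finite I" "\<alpha> \<in> degree_indices I d"
  shows "support \<alpha> \<subseteq> I" "finite (support \<alpha>)" "card (support \<alpha>) \<le> d" "\<alpha> \<in> box_indices (support \<alpha>) d"
proof -
  have "\<alpha> i = 0" if "i \<notin> I" for i
    using that assms by (simp add: degree_indices_def box_indices_def)
  then show sub: "support \<alpha> \<subseteq> I" unfolding support_def by (intro subsetI) force
  show fin: "finite (support \<alpha>)" by (rule finite_subset[OF sub assms(1)])
  have "card (support \<alpha>) = (\<Sum>i\<in>support \<alpha>. 1)" by simp
  also have "\<dots> \<le> sum \<alpha> (support \<alpha>)" by (rule sum_mono) (auto simp: support_def)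
  also have "\<dots> \<le> sum \<alpha> I" by (rule sum_mono2) (use sub assms in auto)
  also have "\<dots> \<le> d" using assms by (simp add: degree_indices_def)
  finally show "card (support \<alpha>) \<le> d" .
  have "\<alpha> i \<le> d" for i
    using assms by (cases "i \<in> I") (auto simp: degree_indices_def box_indices_def)
  then show "\<alpha> \<in> box_indices (support \<alpha>) d"
    by (simp add: box_indices_def support_def)
qed

text \<open>
  A polynomial of degree at most \<open>d\<close> is determined by its values at vectors with at most \<open>d\<close> nonzero
  coordinates, since each of its monomials involves at most \<open>d\<close> variables. The nodes are so small that all such
  vectors with entries among them lie in the ball, in every dimension. Interpolation from these sparse vectors
  provides a polynomial that depends linearly on \<open>F\<close>, with coefficients bounded independently of the dimension.
\<close>
locale sparse_nodes =
  fixes p :: real and d :: nat and t :: "nat \<Rightarrow> real" and w :: "nat \<Rightarrow> nat \<Rightarrow> real"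
  assumes p_pos: "0 < p" and p_less: "p < 1"
    and weights: "\<And>i k. i \<le> d \<Longrightarrow> k \<le> d \<Longrightarrow> (\<Sum>j\<le>d. w k j * t j ^ i) = (if i = k then 1 else 0)"
    and nodes: "\<And>j. j \<le> d \<Longrightarrow> real d * \<bar>t j\<bar> powr p \<le> 1"
begin

definition coef :: "(nat \<Rightarrow> nat) \<Rightarrow> ((nat \<Rightarrow> real) \<Rightarrow> real) \<Rightarrow> real" where
  "coef \<alpha> F = coef_at w t d (support \<alpha>) \<alpha> F"

definition interpolant :: "nat set \<Rightarrow> ((nat \<Rightarrow> real) \<Rightarrow> real) \<Rightarrow> (nat \<Rightarrow> real) \<Rightarrow> real" where
  "interpolant I F y = (\<Sum>\<alpha>\<in>degree_indices I d. coef \<alpha> F * (\<Prod>i\<in>I. y i ^ \<alpha> i))"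

definition coef_norm :: real where "coef_norm = (\<Sum>k\<le>d. \<Sum>j\<le>d. \<bar>w k j\<bar>) ^ d"

lemma weight_sum_ge_1: "1 \<le> (\<Sum>k\<le>d. \<Sum>j\<le>d. \<bar>w k j\<bar>)"
proof -
  have "1 = (\<Sum>j\<le>d. w 0 j)" using weights[of 0 0] by simp
  also have "\<dots> \<le> (\<Sum>j\<le>d. \<bar>w 0 j\<bar>)" by (intro sum_mono) auto
  also have "\<dots> \<le> (\<Sum>k\<le>d. \<Sum>j\<le>d. \<bar>w k j\<bar>)"
    by (rule member_le_sum) (auto simp: sum_nonneg)
  finally show ?thesis .
qed

lemma coef_norm_ge_1: "1 \<le> coef_norm"
  unfolding coef_norm_def using weight_sum_ge_1 by (rule one_le_power)

lemma node_vec_in_lp_on: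
  assumes "T \<subseteq> I" "finite I" "card T \<le> d" "j \<in> box_indices T d"
  shows "node_vec t T j \<in> lp_on p I"
proof (cases "T = {}")
  case True
  then show ?thesis by (simp add: node_vec_def lp_on_def)
next
  case False
  have fin: "finite T" using assms finite_subset by blast
  have "d > 0" using False fin assms(3) by (cases d) auto
  have "(\<Sum>i\<in>I. \<bar>node_vec t T j i\<bar> powr p) = (\<Sum>i\<in>T. \<bar>t (j i)\<bar> powr p)"
    by (rule sum.mono_neutral_cong_right) (use assms in \<open>auto simp: node_vec_def\<close>)
  also have "\<dots> \<le> (\<Sum>i\<in>T. 1 / real d)"
  proof (rule sum_mono)
    fix i assume "i \<in> T"
    then have "j i \<le> d" using assms by (auto simp: box_indices_def)
    then show "\<bar>t (j i)\<bar> powr p \<le> 1 / real d"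
      using nodes[of "j i"] \<open>d > 0\<close> by (simp add: field_simps)
  qed
  also have "\<dots> \<le> 1" using assms(3) \<open>d > 0\<close> by simp
  finally show ?thesis using assms(1) by (auto simp: lp_on_def node_vec_def)
qed

lemma coef_le:
  assumes "finite I" "\<alpha> \<in> degree_indices I d" and F: "\<And>y. y \<in> lp_on p I \<Longrightarrow> \<bar>F y\<bar> \<le> M"
  shows "\<bar>coef \<alpha> F\<bar> \<le> coef_norm * M"
proof -
  note supp = degree_indices_support[OF assms(1,2)]
  have bound: "\<bar>F (node_vec t (support \<alpha>) j)\<bar> \<le> M" if "j \<in> box_indices (support \<alpha>) d" for j
    by (intro F node_vec_in_lp_on supp assms that)
  from bound[OF supp(4)] have "M \<ge> 0" by linarith
  have "\<bar>coef \<alpha> F\<bar> \<le> (\<Sum>k\<le>d. \<Sum>j\<le>d. \<bar>w k j\<bar>) ^ card (support \<alpha>) * M"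
    unfolding coef_def by (rule coef_at_bound[OF supp(2,4)]) (rule bound)
  also have "\<dots> \<le> coef_norm * M"
    unfolding coef_norm_def
    by (intro mult_right_mono power_increasing supp weight_sum_ge_1 \<open>M \<ge> 0\<close>)
  finally show ?thesis .
qed

lemma coef_polynomial:
  assumes "finite I" "\<alpha> \<in> degree_indices I d"
  shows "coef \<alpha> (\<lambda>y. \<Sum>\<beta>\<in>degree_indices I d. c \<beta> * (\<Prod>i\<in>I. y i ^ \<beta> i)) = c \<alpha>"
  unfolding coef_def using degree_indices_support[OF assms]
  by (intro coef_at_polynomial[OF weights assms(1)]) (use assms degree_indices_subset in auto)

lemma coef_diff: "coef \<alpha> (\<lambda>y. F y - G y) = coef \<alpha> F - coef \<alpha> G"
  by (simp add: coef_def coef_at_diff)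

lemma coef_residual:
  assumes "finite I" "\<alpha> \<in> degree_indices I d"
  shows "coef \<alpha> (\<lambda>y. F y - interpolant I F y) = 0"
  unfolding coef_diff unfolding interpolant_def coef_polynomial[OF assms] by simp

lemma monomial_sum_le:
  assumes "finite I" and y: "y \<in> lp_on p I"
  shows "(\<Sum>\<alpha>\<in>box_indices I d. \<Prod>i\<in>I. \<bar>y i\<bar> ^ \<alpha> i) \<le> real (Suc d) ^ card I"
proof -
  have "(\<Sum>\<alpha>\<in>box_indices I d. \<Prod>i\<in>I. \<bar>y i\<bar> ^ \<alpha> i) = (\<Prod>i\<in>I. \<Sum>k\<le>d. \<bar>y i\<bar> ^ k)"
    by (rule prod_sum_box_indices[symmetric]) fact
  also have "\<dots> \<le> (\<Prod>i\<in>I. real (Suc d))"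
  proof (intro prod_mono conjI sum_nonneg)
    fix i
    have "(\<Sum>k\<le>d. \<bar>y i\<bar> ^ k) \<le> (\<Sum>k\<le>d. 1)"
      by (intro sum_mono power_le_one) (use lp_on_abs_le[OF y assms(1) p_pos] in auto)
    then show "(\<Sum>k\<le>d. \<bar>y i\<bar> ^ k) \<le> real (Suc d)" by simp
  qed auto
  finally show ?thesis by simp
qed

lemma interpolant_le:
  assumes "finite I" and F: "\<And>y. y \<in> lp_on p I \<Longrightarrow> \<bar>F y\<bar> \<le> M" and y: "y \<in> lp_on p I"
  shows "\<bar>interpolant I F y\<bar> \<le> coef_norm * M * real (Suc d) ^ card I"
proof -
  have "M \<ge> 0" using F[OF y] by linarith
  then have "coef_norm * M \<ge> 0" using coef_norm_ge_1 by simp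
  have "\<bar>interpolant I F y\<bar> \<le> (\<Sum>\<alpha>\<in>degree_indices I d. coef_norm * M * (\<Prod>i\<in>I. \<bar>y i\<bar> ^ \<alpha> i))"
    unfolding interpolant_def
  proof (rule order_trans[OF sum_abs sum_mono])
    fix \<alpha> assume "\<alpha> \<in> degree_indices I d"
    then have "\<bar>coef \<alpha> F\<bar> \<le> coef_norm * M" by (intro coef_le[OF assms(1) _ F])
    then show "\<bar>coef \<alpha> F * (\<Prod>i\<in>I. y i ^ \<alpha> i)\<bar> \<le> coef_norm * M * (\<Prod>i\<in>I. \<bar>y i\<bar> ^ \<alpha> i)"
      by (simp add: abs_mult abs_prod power_abs mult_right_mono prod_nonneg)
  qed
  also have "\<dots> \<le> (\<Sum>\<alpha>\<in>box_indices I d. coef_norm * M * (\<Prod>i\<in>I. \<bar>y i\<bar> ^ \<alpha> i))"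
    by (rule sum_mono2)
       (use finite_box_indices[OF assms(1)] degree_indices_subset \<open>coef_norm * M \<ge> 0\<close>
        in \<open>auto intro!: mult_nonneg_nonneg[of "coef_norm * M"] prod_nonneg\<close>)
  also have "\<dots> \<le> coef_norm * M * real (Suc d) ^ card I"
    unfolding sum_distrib_left[symmetric]
    by (intro mult_left_mono monomial_sum_le assms y \<open>coef_norm * M \<ge> 0\<close>)
  finally show ?thesis .
qed

lemma tame_residual:
  assumes "finite I" "tame p (Suc d) I F"
  shows "tame p (Suc d) I (\<lambda>y. F y - interpolant I F y)"
proof -
  from assms obtain B where B: "\<And>y. y \<in> lp_on p I \<Longrightarrow> \<bar>F y\<bar> \<le> B" by (auto simp: tame_def)
  have "\<bar>F y - interpolant I F y\<bar> \<le> B + coef_norm * B * real (Suc d) ^ card I" if "y \<in> lp_on p I" for y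
  proof -
    have "\<bar>interpolant I F y\<bar> \<le> coef_norm * B * real (Suc d) ^ card I"
      by (rule interpolant_le[OF assms(1)]) (use B that in auto)
    then show ?thesis using B[OF that] by linarith
  qed
  moreover have "fin_diff (Suc d) h (interpolant I F) x = 0" for h x
    unfolding interpolant_def fin_diff_sum using fin_diff_monomial[OF assms(1)] by simp
  ultimately show ?thesis
    using assms(2) unfolding tame_def fin_diff_minus by auto
qed

text \<open>
  The sparse interpolant reproduces polynomials of degree at most \<open>d\<close>, so it is as good as the best
  approximation up to its norm, which is finite in bounded dimension.
\<close>
lemma interpolant_close_bounded_dimension:
  obtains W :: real where
    "\<And>I F y. finite I \<Longrightarrow> card I \<le> N \<Longrightarrow> tame p (Suc d) I F \<Longrightarrow> y \<in> lp_on p I \<Longrightarrow>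
      \<bar>F y - interpolant I F y\<bar> \<le> W"
proof -
  obtain W where "W \<ge> 0" and W:
    "\<And>I F. finite I \<Longrightarrow> card I \<le> N \<Longrightarrow> tame p (Suc d) I F \<Longrightarrow>
      \<exists>c. \<forall>y\<in>lp_on p I. \<bar>F y - (\<Sum>\<alpha>\<in>degree_indices I d. c \<alpha> * (\<Prod>i\<in>I. y i ^ \<alpha> i))\<bar> \<le> W"
    by (fact whitney_bounded_dimension[OF p_pos, of N d thesis])
  show thesis
  proof (rule that[of "W + coef_norm * W * real (Suc d) ^ N"])
    fix I F y assume I: "finite I" "card I \<le> N" and "tame p (Suc d) I F" and y: "y \<in> lp_on p I"
    then obtain c where c:
      "\<And>y. y \<in> lp_on p I \<Longrightarrow> \<bar>F y - (\<Sum>\<alpha>\<in>degree_indices I d. c \<alpha> * (\<Prod>i\<in>I. y i ^ \<alpha> i))\<bar> \<le> W"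
      using W by blast
    let ?P = "\<lambda>y. \<Sum>\<alpha>\<in>degree_indices I d. c \<alpha> * (\<Prod>i\<in>I. y i ^ \<alpha> i)"
    have "interpolant I (\<lambda>y. F y - ?P y) y = interpolant I F y - ?P y"
      by (simp add: interpolant_def coef_diff coef_polynomial[OF I(1)] left_diff_distrib sum_subtractf)
    moreover have "\<bar>interpolant I (\<lambda>y. F y - ?P y) y\<bar> \<le> coef_norm * W * real (Suc d) ^ card I"
      by (rule interpolant_le[OF I(1)]) (use c y in auto)
    ultimately have "\<bar>interpolant I F y - ?P y\<bar> \<le> coef_norm * W * real (Suc d) ^ card I"
      by simp
    also have "\<dots> \<le> coef_norm * W * real (Suc d) ^ N"
      using I \<open>W \<ge> 0\<close> coef_norm_ge_1 by (intro mult_left_mono power_increasing) auto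
    finally show "\<bar>F y - interpolant I F y\<bar> \<le> W + coef_norm * W * real (Suc d) ^ N"
      using c[OF y] by linarith
  qed
qed

end

section \<open>Grouping coordinates\<close>

text \<open>
  The map \<open>r\<close> sends each coordinate to the representative of its group. Coordinates are added one by one: a light
  one joins a light group if there is one, and otherwise starts a group of its own. A group of at least two
  coordinates thus consists of two light parts, and at most one group is light, which limits the number of
  groups.
\<close>
lemma group_coordinates:
  fixes \<mu> :: "nat \<Rightarrow> real"
  assumes "finite A" "\<And>i. \<mu> i \<ge> 0" "sum \<mu> A \<le> 1" "\<eta> > 0"
  obtains r where "r ` A \<subseteq> A" "\<And>i. i \<in> r ` A \<Longrightarrow> r i = i"
    "real (card (r ` A)) \<le> 1 / \<eta> + 1"
    "\<And>i. i \<in> r ` A \<Longrightarrow> {k \<in> A. r k = i} = {i} \<or> sum \<mu> {k \<in> A. r k = i} \<le> 2 * \<eta>"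
proof -
  define mass where "mass B r i = sum \<mu> {k \<in> B. r k = i}" for B and r :: "nat \<Rightarrow> nat" and i
  define good where "good B r \<longleftrightarrow> r ` B \<subseteq> B \<and> (\<forall>i\<in>r ` B. r i = i) \<and>
      (\<forall>i\<in>r ` B. {k \<in> B. r k = i} = {i} \<or> mass B r i \<le> 2 * \<eta>) \<and>
      (\<forall>i\<in>r ` B. \<forall>j\<in>r ` B. i \<noteq> j \<longrightarrow> mass B r i > \<eta> \<or> mass B r j > \<eta>)" for B r
  have "\<exists>r. good A r"
    using \<open>finite A\<close>
  proof (induction A)
    case (insert a A)
    then obtain r where "good A r" by blast
    then have r: "r ` A \<subseteq> A" "\<And>i. i \<in> r ` A \<Longrightarrow> r i = i"
      "\<And>i. i \<in> r ` A \<Longrightarrow> {k \<in> A. r k = i} = {i} \<or> mass A r i \<le> 2 * \<eta>"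
      "\<And>i j. i \<in> r ` A \<Longrightarrow> j \<in> r ` A \<Longrightarrow> i \<noteq> j \<Longrightarrow> mass A r i > \<eta> \<or> mass A r j > \<eta>"
      unfolding good_def by blast+
    have img: "r(a := b) ` insert a A = insert b (r ` A)" for b
      using insert.hyps by (auto simp: image_iff)
    have fiber: "{k \<in> insert a A. (r(a := b)) k = i} =
        (if i = b then insert a {k \<in> A. r k = i} else {k \<in> A. r k = i})" for b i
      using insert.hyps by auto
    have mass: "mass (insert a A) (r(a := b)) i = (if i = b then \<mu> a else 0) + mass A r i" for b i
      unfolding mass_def fiber using insert.hyps by simp
    have mass_mono: "mass A r i \<le> mass (insert a A) (r(a := b)) i" for b i
      using assms(2)[of a] by (simp add: mass)
    show ?case
    proof (cases "\<exists>i\<in>r ` A. mass A r i \<le> \<eta> \<and> \<mu> a \<le> \<eta>")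
      case True
      then obtain b where b: "b \<in> r ` A" "mass A r b \<le> \<eta>" "\<mu> a \<le> \<eta>" by blast
      have img': "r(a := b) ` insert a A = r ` A" using b img by auto
      have "a \<notin> r ` A" using r(1) insert.hyps by blast
      have "good (insert a A) (r(a := b))"
        unfolding good_def img'
      proof (intro conjI ballI impI)
        show "r ` A \<subseteq> insert a A" using r(1) by blast
        show "(r(a := b)) i = i" if "i \<in> r ` A" for i
          using r(2)[OF that] that \<open>a \<notin> r ` A\<close> by (cases "i = a") simp_all
        show "{k \<in> insert a A. (r(a := b)) k = i} = {i} \<or> mass (insert a A) (r(a := b)) i \<le> 2 * \<eta>"
          if "i \<in> r ` A" for i
          using r(3)[OF that] b unfolding mass fiber by auto
        show "mass (insert a A) (r(a := b)) i > \<eta> \<or> mass (insert a A) (r(a := b)) j > \<eta>"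
          if "i \<in> r ` A" "j \<in> r ` A" "i \<noteq> j" for i j
          using r(4)[OF that] mass_mono[of i b] mass_mono[of j b] by linarith
      qed
      then show ?thesis by blast
    next
      case False
      have "a \<notin> r ` A" using r(1) insert.hyps by blast
      then have empty: "{k \<in> A. r k = a} = {}" by auto
      then have mass_a: "mass (insert a A) (r(a := a)) a = \<mu> a"
        unfolding mass by (simp add: mass_def empty del: Collect_empty_eq)
      have mass_other: "mass (insert a A) (r(a := a)) i = mass A r i" if "i \<noteq> a" for i
        using that by (simp add: mass)
      have "good (insert a A) (r(a := a))"
        unfolding good_def img
      proof (intro conjI ballI impI)
        show "insert a (r ` A) \<subseteq> insert a A" using r(1) by blast
        show "(r(a := a)) i = i" if "i \<in> insert a (r ` A)" for i
          using that r(2)[of i] by (cases "i = a") simp_all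
        show "{k \<in> insert a A. (r(a := a)) k = i} = {i} \<or> mass (insert a A) (r(a := a)) i \<le> 2 * \<eta>"
          if "i \<in> insert a (r ` A)" for i
          using r(3)[of i] that empty \<open>a \<notin> r ` A\<close> unfolding fiber by (auto simp: mass_other)
        show "mass (insert a A) (r(a := a)) i > \<eta> \<or> mass (insert a A) (r(a := a)) j > \<eta>"
          if "i \<in> insert a (r ` A)" "j \<in> insert a (r ` A)" "i \<noteq> j" for i j
          using that False r(4)[of i j] \<open>a \<notin> r ` A\<close> mass_a mass_other
          by (cases "i = a"; cases "j = a") (auto simp: not_le)
      qed
      then show ?thesis by blast
    qed
  qed (simp add: good_def)
  then obtain r where "good A r" by blast
  then have r: "r ` A \<subseteq> A" "\<And>i. i \<in> r ` A \<Longrightarrow> r i = i"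
      "\<And>i. i \<in> r ` A \<Longrightarrow> {k \<in> A. r k = i} = {i} \<or> mass A r i \<le> 2 * \<eta>"
      "\<And>i j. i \<in> r ` A \<Longrightarrow> j \<in> r ` A \<Longrightarrow> i \<noteq> j \<Longrightarrow> mass A r i > \<eta> \<or> mass A r j > \<eta>"
    unfolding good_def by blast+
  define B where "B = {i \<in> r ` A. mass A r i \<le> \<eta>}"
  have fin: "finite (r ` A)" "finite B" using \<open>finite A\<close> by (auto simp: B_def)
  have "card B \<le> 1"
    using fin(2) r(4) by (intro card_le_Suc0_iff_eq[THEN iffD2, unfolded One_nat_def[symmetric]])
      (force simp: B_def)+
  have mass_nonneg: "mass A r i \<ge> 0" for i
    unfolding mass_def by (rule sum_nonneg) (rule assms)
  have "real (card (r ` A - B)) * \<eta> \<le> (\<Sum>i\<in>r ` A - B. mass A r i)"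
    by (rule sum_bounded_below) (auto simp: B_def)
  also have "\<dots> \<le> (\<Sum>i\<in>r ` A. mass A r i)"
    by (rule sum_mono2) (use fin mass_nonneg in auto)
  also have "\<dots> = sum \<mu> A"
    unfolding mass_def by (rule sum.group) (use assms in auto)
  finally have "real (card (r ` A - B)) \<le> 1 / \<eta>"
    using assms(3,4) by (simp add: field_simps)
  moreover have "card (r ` A) = card (r ` A - B) + card B"
    using fin by (metis (no_types, lifting) B_def card_Diff_subset card_mono le_add_diff_inverse2 mem_Collect_eq subsetI)
  ultimately have "real (card (r ` A)) \<le> 1 / \<eta> + 1"
    using \<open>card B \<le> 1\<close> by linarith
  then show thesis using r(1-3) by (intro that[of r]) (simp_all only: mass_def)
qed

section \<open>The dimension-free bound\<close>
text \<open>
  The linear map that sends the unit vector of the representative \<open>i\<close> to the restriction of \<open>s\<close> to the group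
  of \<open>i\<close>.
\<close>
definition spread :: "nat set \<Rightarrow> (nat \<Rightarrow> nat) \<Rightarrow> (nat \<Rightarrow> real) \<Rightarrow> (nat \<Rightarrow> real) \<Rightarrow> nat \<Rightarrow> real" where
  "spread A r s y = (\<lambda>k. if k \<in> A then y (r k) * s k else 0)"

text \<open>
  If each group carries a vector of the ball, then the ball in the space of groups is mapped into the original
  ball. Functions on the latter can therefore be studied in as few dimensions as there are groups.
\<close>
lemma spread_in_lp_on:
  assumes "finite A" and s: "\<And>i. i \<in> r ` A \<Longrightarrow> (\<Sum>k | k \<in> A \<and> r k = i. \<bar>s k\<bar> powr p) \<le> 1"
    and y: "y \<in> lp_on p (r ` A)"
  shows "spread A r s y \<in> lp_on p A"
proof -
  have "(\<Sum>k\<in>A. \<bar>spread A r s y k\<bar> powr p) = (\<Sum>k\<in>A. \<bar>y (r k)\<bar> powr p * \<bar>s k\<bar> powr p)"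
    by (rule sum.cong) (auto simp: spread_def abs_mult powr_mult)
  also have "\<dots> = (\<Sum>i\<in>r ` A. \<Sum>k | k \<in> A \<and> r k = i. \<bar>y (r k)\<bar> powr p * \<bar>s k\<bar> powr p)"
    by (rule sum.group[symmetric]) (use assms in auto)
  also have "\<dots> = (\<Sum>i\<in>r ` A. \<bar>y i\<bar> powr p * (\<Sum>k | k \<in> A \<and> r k = i. \<bar>s k\<bar> powr p))"
    by (simp add: sum_distrib_left)
  also have "\<dots> \<le> (\<Sum>i\<in>r ` A. \<bar>y i\<bar> powr p * 1)"
    by (intro sum_mono mult_left_mono s) auto
  also have "\<dots> \<le> 1" using y by (simp add: lp_on_def)
  finally show ?thesis by (simp add: lp_on_def spread_def)
qed

lemma tame_spread:
  assumes "finite A" and s: "\<And>i. i \<in> r ` A \<Longrightarrow> (\<Sum>k | k \<in> A \<and> r k = i. \<bar>s k\<bar> powr p) \<le> 1"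
    and F: "tame p m A F"
  shows "tame p m (r ` A) (\<lambda>y. F (spread A r s y))"
proof -
  note mem = spread_in_lp_on[OF assms(1) s]
  have sh: "spread A r s (shift x h j) = shift (spread A r s x) (spread A r s h) j" for x h j
    by (simp add: spread_def shift_def fun_eq_iff distrib_right)
  have diff: "fin_diff m h (\<lambda>y. F (spread A r s y)) x = fin_diff m (spread A r s h) F (spread A r s x)" for x h
    by (simp add: fin_diff_def sh)
  from F obtain B where B: "\<And>y. y \<in> lp_on p A \<Longrightarrow> \<bar>F y\<bar> \<le> B" by (auto simp: tame_def)
  have "\<bar>F (spread A r s y)\<bar> \<le> B" if "y \<in> lp_on p (r ` A)" for y
    by (intro B mem that)
  moreover have "\<bar>fin_diff m h (\<lambda>y. F (spread A r s y)) x\<bar> \<le> 1"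
    if "\<forall>j\<le>m. shift x h j \<in> lp_on p (r ` A)" for x h
  proof -
    have "\<forall>j\<le>m. shift (spread A r s x) (spread A r s h) j \<in> lp_on p A"
      unfolding sh[symmetric] by (intro allI impI mem) (use that in auto)
    then show ?thesis using F unfolding diff tame_def by blast
  qed
  ultimately show ?thesis unfolding tame_def by blast
qed

text \<open>
  The monomials that involve a coordinate outside \<open>H\<close> contribute little if those coordinates have a small sum, no
  matter how many coordinates there are: both sums factorise over the coordinates, and each factor is at most
  \<open>1 + d * \<bar>y i\<bar> \<le> exp (d * \<bar>y i\<bar>)\<close>.
\<close>
lemma monomial_tail_le:
  fixes y :: "nat \<Rightarrow> real"
  assumes fin: "finite I" "H \<subseteq> I" and y: "\<And>i. i \<in> I \<Longrightarrow> \<bar>y i\<bar> \<le> 1"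
    and H: "(\<Sum>i\<in>H. \<bar>y i\<bar>) \<le> 1" and rest: "(\<Sum>i\<in>I - H. \<bar>y i\<bar>) \<le> \<sigma>"
  shows "(\<Sum>\<alpha>\<in>box_indices I d - box_indices H d. \<Prod>i\<in>I. \<bar>y i\<bar> ^ \<alpha> i) \<le>
    exp (real d) * (exp (real d * \<sigma>) - 1)"
proof -
  define S where "S i = (\<Sum>k\<le>d. \<bar>y i\<bar> ^ k)" for i
  have S_ge: "1 \<le> S i" for i
    unfolding S_def using member_le_sum[of 0 "{..d}" "\<lambda>k. \<bar>y i\<bar> ^ k"] by simp
  have S_le: "S i \<le> exp (real d * \<bar>y i\<bar>)" if "i \<in> I" for i
  proof -
    have "S i = 1 + (\<Sum>k\<in>{..d} - {0}. \<bar>y i\<bar> ^ k)"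
      unfolding S_def by (subst sum.remove[of _ 0]) auto
    also have "(\<Sum>k\<in>{..d} - {0}. \<bar>y i\<bar> ^ k) \<le> (\<Sum>k\<in>{..d} - {0}. \<bar>y i\<bar>)"
    proof (rule sum_mono)
      fix k assume "k \<in> {..d} - {0}"
      then show "\<bar>y i\<bar> ^ k \<le> \<bar>y i\<bar>"
        using power_decreasing[of 1 k "\<bar>y i\<bar>"] y[OF that] by simp
    qed
    also have "1 + \<dots> = 1 + real d * \<bar>y i\<bar>" by simp
    also have "\<dots> \<le> exp (real d * \<bar>y i\<bar>)" by (rule exp_ge_add_one_self)
    finally show ?thesis by simp
  qed
  have prod_le: "(\<Prod>i\<in>J. S i) \<le> exp (real d * \<tau>)" if "J \<subseteq> I" "(\<Sum>i\<in>J. \<bar>y i\<bar>) \<le> \<tau>" for J \<tau>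
  proof -
    have "finite J" using that fin finite_subset by blast
    have "(\<Prod>i\<in>J. S i) \<le> (\<Prod>i\<in>J. exp (real d * \<bar>y i\<bar>))"
      using that S_ge S_le by (intro prod_mono conjI order_trans[OF zero_le_one]) auto
    also have "\<dots> = exp (real d * (\<Sum>i\<in>J. \<bar>y i\<bar>))"
      by (simp add: exp_sum[OF \<open>finite J\<close>] sum_distrib_left)
    also have "\<dots> \<le> exp (real d * \<tau>)" using that by (simp add: mult_left_mono)
    finally show ?thesis .
  qed
  have sub: "box_indices H d \<subseteq> box_indices I d"
  proof
    fix \<alpha> assume \<alpha>: "\<alpha> \<in> box_indices H d"
    then have "\<alpha> i \<le> d" for i by (cases "i \<in> H") (auto simp: box_indices_def)
    with \<alpha> fin(2) show "\<alpha> \<in> box_indices I d" by (auto simp: box_indices_def)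
  qed
  have "(\<Sum>\<alpha>\<in>box_indices I d - box_indices H d. \<Prod>i\<in>I. \<bar>y i\<bar> ^ \<alpha> i) =
      (\<Sum>\<alpha>\<in>box_indices I d. \<Prod>i\<in>I. \<bar>y i\<bar> ^ \<alpha> i) - (\<Sum>\<alpha>\<in>box_indices H d. \<Prod>i\<in>I. \<bar>y i\<bar> ^ \<alpha> i)"
    by (rule sum_diff[OF finite_box_indices[OF fin(1)] sub])
  also have "(\<Sum>\<alpha>\<in>box_indices I d. \<Prod>i\<in>I. \<bar>y i\<bar> ^ \<alpha> i) = (\<Prod>i\<in>I. S i)"
    unfolding S_def by (rule prod_sum_box_indices[symmetric]) fact
  also have "(\<Sum>\<alpha>\<in>box_indices H d. \<Prod>i\<in>I. \<bar>y i\<bar> ^ \<alpha> i) = (\<Prod>i\<in>H. S i)"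
    unfolding S_def by (subst sum_box_indices_restrict[OF fin]) simp
  also have "(\<Prod>i\<in>I. S i) = (\<Prod>i\<in>I - H. S i) * (\<Prod>i\<in>H. S i)"
    by (rule prod.subset_diff) (use fin in auto)
  also have "\<dots> - (\<Prod>i\<in>H. S i) = (\<Prod>i\<in>H. S i) * ((\<Prod>i\<in>I - H. S i) - 1)"
    by (simp add: algebra_simps)
  also have "\<dots> \<le> exp (real d * 1) * (exp (real d * \<sigma>) - 1)"
  proof (rule mult_mono)
    show "(\<Prod>i\<in>H. S i) \<le> exp (real d * 1)" by (rule prod_le[OF fin(2) H])
    show "(\<Prod>i\<in>I - H. S i) - 1 \<le> exp (real d * \<sigma>) - 1" using prod_le[OF _ rest] by simp
    show "0 \<le> (\<Prod>i\<in>I - H. S i) - 1" using prod_ge_1[of "I - H" S] S_ge by simp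
  qed simp
  finally show ?thesis by simp
qed

context sparse_nodes
begin

lemma coef_cong_support:
  assumes "\<And>y. (\<And>i. i \<notin> support \<alpha> \<Longrightarrow> y i = 0) \<Longrightarrow> F y = G y"
  shows "coef \<alpha> F = coef \<alpha> G"
  unfolding coef_def coef_at_def
  by (intro sum.cong refl arg_cong2[where f = times] assms) (simp add: node_vec_def)

text \<open>
  Group the coordinates of \<open>x\<close> into at most \<open>N\<close> groups and restrict \<open>g\<close> to the span of the groups. There the
  sparse interpolant approximates \<open>g\<close> up to \<open>W\<close>. Its monomials that only involve singleton groups (the set \<open>H\<close>)
  have coefficients that are coefficients of \<open>g\<close> itself, hence zero. The others have coefficients of size at
  most a constant times \<open>M\<close>, but involve a group of small mass. As \<open>p < 1\<close>, the norms \<open>mass powr (1 / p)\<close> of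
  these groups have a small sum: it is at most \<open>(2 * \<eta>) powr (1 / p - 1)\<close> times the total mass.
\<close>
lemma grouped_contraction:
  assumes A: "finite A" and tame: "tame p (Suc d) A g"
    and zero: "\<And>\<alpha>. \<alpha> \<in> degree_indices A d \<Longrightarrow> coef \<alpha> g = 0"
    and W: "\<And>I F y. finite I \<Longrightarrow> card I \<le> N \<Longrightarrow> tame p (Suc d) I F \<Longrightarrow> y \<in> lp_on p I \<Longrightarrow>
      \<bar>F y - interpolant I F y\<bar> \<le> W"
    and \<eta>: "\<eta> > 0" "1 / \<eta> + 1 \<le> real N"
    and small: "coef_norm * (exp (real d) * (exp (real d * (2 * \<eta>) powr (1 / p - 1)) - 1)) \<le> 1 / 2"
    and M: "\<And>z. z \<in> lp_on p A \<Longrightarrow> \<bar>g z\<bar> \<le> M" and x: "x \<in> lp_on p A"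
  shows "\<bar>g x\<bar> \<le> M / 2 + W"
proof -
  have "M \<ge> 0" using M[OF x] by linarith
  define \<mu> where "\<mu> k = \<bar>x k\<bar> powr p" for k
  have \<mu>: "\<And>k. \<mu> k \<ge> 0" "sum \<mu> A \<le> 1" using x by (simp_all add: \<mu>_def lp_on_def)
  obtain r where r: "r ` A \<subseteq> A" "\<And>i. i \<in> r ` A \<Longrightarrow> r i = i"
    "real (card (r ` A)) \<le> 1 / \<eta> + 1"
    "\<And>i. i \<in> r ` A \<Longrightarrow> {k \<in> A. r k = i} = {i} \<or> sum \<mu> {k \<in> A. r k = i} \<le> 2 * \<eta>"
    by (fact group_coordinates[OF A \<mu> \<eta>(1), where thesis = thesis])
  define I where "I = r ` A"
  have "real (card I) \<le> real N" using r(3) \<eta>(2) unfolding I_def by linarith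
  then have I: "finite I" "card I \<le> N" using A by (simp_all add: I_def)
  define fiber where "fiber i = {k \<in> A. r k = i}" for i
  define mass where "mass i = sum \<mu> (fiber i)" for i
  have mass_nonneg: "mass i \<ge> 0" for i unfolding mass_def by (rule sum_nonneg) (rule \<mu>)
  have fin: "finite (fiber i)" for i using A by (simp add: fiber_def)
  define H where "H = {i \<in> I. fiber i = {i}}"
  have H: "fiber i = {i}" if "i \<in> H" for i using that by (simp add: H_def)
  have "H \<subseteq> I" by (auto simp: H_def)
  \<comment> \<open>The span is coordinatised such that a singleton group contributes the unit vector, with coordinate \<open>x i\<close>,
    and any other group its normalised part of \<open>x\<close>, with the norm of this part as coordinate. For a group of
    mass zero the division by zero makes the vector zero, which is the part of \<open>x\<close> there.\<close>
  define s where "s k = (if r k \<in> H then 1 else x k / mass (r k) powr (1 / p))" for k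
  define y where "y i = (if i \<in> H then x i else if i \<in> I then mass i powr (1 / p) else 0)" for i
  have s_le: "(\<Sum>k | k \<in> A \<and> r k = i. \<bar>s k\<bar> powr p) \<le> 1" if "i \<in> r ` A" for i
  proof (cases "i \<in> H")
    case True
    have "(\<Sum>k\<in>fiber i. \<bar>s k\<bar> powr p) = \<bar>s i\<bar> powr p" using H[OF True] by simp
    also have "r i = i" using r(2) that by blast
    then have "\<bar>s i\<bar> powr p = 1" using True by (simp add: s_def)
    finally show ?thesis by (simp add: fiber_def)
  next
    case False
    have "(\<Sum>k\<in>fiber i. \<bar>s k\<bar> powr p) = (\<Sum>k\<in>fiber i. \<mu> k / mass i)"
      by (rule sum.cong) (use False mass_nonneg[of i] p_pos in
        \<open>auto simp: s_def fiber_def \<mu>_def abs_divide powr_divide powr_powr\<close>)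
    also have "\<dots> = mass i / mass i" unfolding mass_def by (rule sum_divide_distrib[symmetric])
    also have "\<dots> \<le> 1" by simp
    finally show ?thesis by (simp add: fiber_def)
  qed
  have y_powr: "\<bar>y i\<bar> powr p = mass i" if "i \<in> I" for i
    using that H[of i] mass_nonneg[of i] p_pos by (auto simp: y_def mass_def \<mu>_def powr_powr)
  have y_sum: "(\<Sum>i\<in>I. \<bar>y i\<bar> powr p) \<le> 1"
  proof -
    have "(\<Sum>i\<in>I. \<bar>y i\<bar> powr p) = (\<Sum>i\<in>I. sum \<mu> {k \<in> A. r k = i})"
      by (intro sum.cong refl) (simp add: y_powr mass_def fiber_def)
    also have "\<dots> = sum \<mu> A" by (rule sum.group) (use A I in \<open>auto simp: I_def\<close>)
    finally show ?thesis using \<mu> by simp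
  qed
  have y: "y \<in> lp_on p I"
    using y_sum \<open>H \<subseteq> I\<close> by (auto simp: lp_on_def y_def)
  have y1: "\<bar>y i\<bar> \<le> 1" for i by (rule lp_on_abs_le[OF y I(1) p_pos])
  have spread_y: "spread A r s y = x"
  proof
    fix k
    show "spread A r s y k = x k"
    proof (cases "k \<in> A")
      case False
      then show ?thesis using x by (simp add: spread_def lp_on_def)
    next
      case True
      then have k: "k \<in> fiber (r k)" "r k \<in> I" by (auto simp: fiber_def I_def)
      show ?thesis
      proof (cases "r k \<in> H")
        case True
        then have "r k = k" using k(1) H[OF True] by (metis singletonD)
        then show ?thesis using True \<open>k \<in> A\<close> by (simp add: spread_def y_def s_def)
      next
        case False
        show ?thesis
        proof (cases "mass (r k) = 0")
          case True
          then have "\<mu> k = 0"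
            using sum_nonneg_eq_0_iff[OF fin[of "r k"], of \<mu>] \<mu>(1) k(1) unfolding mass_def by blast
          then have "x k = 0" by (simp add: \<mu>_def)
          then show ?thesis by (simp add: spread_def s_def False)
        next
          case nz: False
          then show ?thesis using False k \<open>k \<in> A\<close> by (simp add: spread_def y_def s_def)
        qed
      qed
    qed
  qed
  define F where "F = (\<lambda>z. g (spread A r s z))"
  have F_tame: "tame p (Suc d) I F"
    unfolding F_def I_def by (rule tame_spread[OF A s_le tame])
  have F_le: "\<bar>F z\<bar> \<le> M" if "z \<in> lp_on p I" for z
    unfolding F_def by (intro M spread_in_lp_on[OF A s_le]) (use that in \<open>auto simp: I_def\<close>)
  have coef_H: "coef \<alpha> F = 0" if \<alpha>: "\<alpha> \<in> degree_indices I d" "\<alpha> \<in> box_indices H d" for \<alpha>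
  proof -
    have supp: "support \<alpha> \<subseteq> H"
    proof
      fix i assume "i \<in> support \<alpha>"
      then show "i \<in> H" using \<alpha>(2) by (cases "i \<in> H") (auto simp: support_def box_indices_def)
    qed
    \<comment> \<open>On vectors supported by singleton groups the embedding is the identity.\<close>
    have "spread A r s z = z" if z: "\<And>i. i \<notin> support \<alpha> \<Longrightarrow> z i = 0" for z
    proof
      fix k
      show "spread A r s z k = z k"
      proof (cases "k \<in> A")
        case False
        then have "k \<notin> support \<alpha>" using supp \<open>H \<subseteq> I\<close> r(1) by (auto simp: I_def)
        then show ?thesis using False z by (simp add: spread_def)
      next
        case True
        then have k: "k \<in> fiber (r k)" by (auto simp: fiber_def)
        show ?thesis
        proof (cases "r k \<in> H")
          case True
          then have "r k = k" using k(1) H[OF True] by (metis singletonD)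
          then show ?thesis using True \<open>k \<in> A\<close> by (simp add: spread_def s_def)
        next
          case False
          have "k \<notin> H"
          proof
            assume "k \<in> H"
            then have "k \<in> r ` A" by (auto simp: H_def I_def)
            then have "r k = k" by (rule r(2))
            then show False using \<open>k \<in> H\<close> False by simp
          qed
          then have "z k = 0" "z (r k) = 0" using False supp z by blast+
          then show ?thesis by (simp add: spread_def)
        qed
      qed
    qed
    then have "coef \<alpha> F = coef \<alpha> g"
      unfolding F_def by (intro coef_cong_support) simp
    also have "coef \<alpha> g = 0"
    proof (rule zero)
      have off_I: "\<alpha> i = 0" if "i \<notin> I" for i
        using that \<alpha>(1) by (simp add: degree_indices_def box_indices_def)
      have "I \<subseteq> A" using r(1) by (simp add: I_def)
      have "\<alpha> i \<le> d" for i
        using \<alpha>(1) by (cases "i \<in> I") (auto simp: degree_indices_def box_indices_def)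
      moreover have "\<alpha> i = 0" if "i \<notin> A" for i
        using that \<open>I \<subseteq> A\<close> off_I by blast
      moreover have "sum \<alpha> A = sum \<alpha> I"
        by (rule sum.mono_neutral_right) (use A \<open>I \<subseteq> A\<close> off_I in auto)
      ultimately show "\<alpha> \<in> degree_indices A d"
        using \<alpha>(1) by (simp add: degree_indices_def box_indices_def)
    qed
    finally show ?thesis .
  qed
  have "\<bar>F y\<bar> \<le> W + \<bar>interpolant I F y\<bar>"
    using W[OF I F_tame y] by linarith
  also have "\<bar>interpolant I F y\<bar> \<le> (\<Sum>\<alpha>\<in>degree_indices I d. \<bar>coef \<alpha> F\<bar> * (\<Prod>i\<in>I. \<bar>y i\<bar> ^ \<alpha> i))"
    unfolding interpolant_def
    by (rule order_trans[OF sum_abs]) (simp add: abs_mult abs_prod power_abs)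
  also have "\<dots> = (\<Sum>\<alpha>\<in>degree_indices I d - box_indices H d. \<bar>coef \<alpha> F\<bar> * (\<Prod>i\<in>I. \<bar>y i\<bar> ^ \<alpha> i))"
    by (rule sum.mono_neutral_right)
       (use coef_H finite_subset[OF degree_indices_subset finite_box_indices[OF I(1)]] in auto)
  also have "\<dots> \<le> (\<Sum>\<alpha>\<in>degree_indices I d - box_indices H d. coef_norm * M * (\<Prod>i\<in>I. \<bar>y i\<bar> ^ \<alpha> i))"
    by (intro sum_mono mult_right_mono coef_le[OF I(1)] F_le prod_nonneg) auto
  also have "\<dots> \<le> (\<Sum>\<alpha>\<in>box_indices I d - box_indices H d. coef_norm * M * (\<Prod>i\<in>I. \<bar>y i\<bar> ^ \<alpha> i))"
    by (rule sum_mono2)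
       (use finite_box_indices[OF I(1)] degree_indices_subset \<open>M \<ge> 0\<close> coef_norm_ge_1 in
        \<open>auto intro!: mult_nonneg_nonneg prod_nonneg\<close>)
  also have "\<dots> \<le> coef_norm * M * (exp (real d) * (exp (real d * (2 * \<eta>) powr (1 / p - 1)) - 1))"
    unfolding sum_distrib_left[symmetric]
  proof (intro mult_left_mono monomial_tail_le I(1) \<open>H \<subseteq> I\<close> y1)
    have le: "\<bar>y i\<bar> \<le> \<bar>y i\<bar> powr p" for i
      using powr_mono'[of p 1 "\<bar>y i\<bar>"] p_less y1[of i] by simp
    have "(\<Sum>i\<in>H. \<bar>y i\<bar>) \<le> (\<Sum>i\<in>H. \<bar>y i\<bar> powr p)" by (intro sum_mono le)
    also have "\<dots> \<le> (\<Sum>i\<in>I. \<bar>y i\<bar> powr p)" by (rule sum_mono2) (use I \<open>H \<subseteq> I\<close> in auto)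
    finally show "(\<Sum>i\<in>H. \<bar>y i\<bar>) \<le> 1" using y_sum by linarith
    have "(\<Sum>i\<in>I - H. \<bar>y i\<bar>) \<le> (\<Sum>i\<in>I - H. mass i * (2 * \<eta>) powr (1 / p - 1))"
    proof (rule sum_mono)
      fix i assume i: "i \<in> I - H"
      then have "mass i \<le> 2 * \<eta>"
        using r(4)[of i] by (auto simp: H_def I_def mass_def fiber_def)
      have "\<bar>y i\<bar> = mass i powr (1 + (1 / p - 1))" using i by (simp add: y_def)
      also have "\<dots> = mass i * mass i powr (1 / p - 1)"
        using mass_nonneg[of i] by (subst powr_add) simp
      also have "\<dots> \<le> mass i * (2 * \<eta>) powr (1 / p - 1)"
        using mass_nonneg[of i] \<open>mass i \<le> 2 * \<eta>\<close> p_pos p_less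
        by (intro mult_left_mono powr_mono2) auto
      finally show "\<bar>y i\<bar> \<le> mass i * (2 * \<eta>) powr (1 / p - 1)" .
    qed
    also have "\<dots> \<le> (\<Sum>i\<in>I. mass i) * (2 * \<eta>) powr (1 / p - 1)"
      unfolding sum_distrib_right[symmetric]
      by (intro mult_right_mono sum_mono2) (use I mass_nonneg in auto)
    also have "\<dots> \<le> 1 * (2 * \<eta>) powr (1 / p - 1)"
      using y_sum y_powr by (intro mult_right_mono) auto
    finally show "(\<Sum>i\<in>I - H. \<bar>y i\<bar>) \<le> (2 * \<eta>) powr (1 / p - 1)" by simp
    show "0 \<le> coef_norm * M" using \<open>M \<ge> 0\<close> coef_norm_ge_1 by simp
  qed
  also have "\<dots> = coef_norm * (exp (real d) * (exp (real d * (2 * \<eta>) powr (1 / p - 1)) - 1)) * M"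
    by (simp add: mult_ac)
  also have "\<dots> \<le> 1 / 2 * M" by (rule mult_right_mono[OF small \<open>M \<ge> 0\<close>])
  finally show ?thesis unfolding F_def spread_y by linarith
qed

text \<open>
  The residual has vanishing sparse coefficients, so once \<open>\<eta>\<close> is small enough the contraction estimate applies
  to its supremum. The threshold for \<open>\<eta>\<close>, the number \<open>N\<close> of groups and the constant \<open>W\<close> for \<open>N\<close> dimensions depend on
  \<open>p\<close> and \<open>d\<close> only.
\<close>
lemma interpolant_close:
  obtains C :: real where
    "\<And>A f x. finite A \<Longrightarrow> tame p (Suc d) A f \<Longrightarrow> x \<in> lp_on p A \<Longrightarrow> \<bar>f x - interpolant A f x\<bar> \<le> C"
proof -
  have "coef_norm > 0" using coef_norm_ge_1 by simp
  define \<sigma> where "\<sigma> = ln (1 + 1 / (2 * coef_norm * exp (real d))) / real (Suc d)"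
  have \<sigma>: "\<sigma> > 0" unfolding \<sigma>_def using \<open>coef_norm > 0\<close> by (intro divide_pos_pos ln_gt_zero) auto
  define \<eta> where "\<eta> = \<sigma> powr (1 / (1 / p - 1)) / 2"
  have "\<eta> > 0" using \<sigma> by (simp add: \<eta>_def)
  have e: "1 / p - 1 > 0" using p_pos p_less by simp
  have \<eta>_\<sigma>: "(2 * \<eta>) powr (1 / p - 1) = \<sigma>"
  proof -
    have root: "(s powr (1 / a)) powr a = s" if "s > 0" "a > 0" for s a :: real
      using that by (simp add: powr_powr)
    have "2 * \<eta> = \<sigma> powr (1 / (1 / p - 1))" by (simp add: \<eta>_def)
    then show ?thesis by (simp only: root[OF \<sigma> e])
  qed
  have "exp (real d * \<sigma>) \<le> exp (real (Suc d) * \<sigma>)" using \<sigma> by simp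
  also have "real (Suc d) * \<sigma> = ln (1 + 1 / (2 * coef_norm * exp (real d)))"
    by (simp add: \<sigma>_def)
  also have "exp \<dots> = 1 + 1 / (2 * coef_norm * exp (real d))"
    using \<open>coef_norm > 0\<close> by (intro exp_ln) (simp add: add_pos_pos)
  finally have "exp (real d * \<sigma>) - 1 \<le> 1 / (2 * coef_norm * exp (real d))" by simp
  then have "coef_norm * (exp (real d) * (exp (real d * \<sigma>) - 1)) \<le>
      coef_norm * (exp (real d) * (1 / (2 * coef_norm * exp (real d))))"
    using \<open>coef_norm > 0\<close> by (intro mult_left_mono) auto
  also have "\<dots> = 1 / 2" using \<open>coef_norm > 0\<close> by simp
  finally have small: "coef_norm * (exp (real d) * (exp (real d * (2 * \<eta>) powr (1 / p - 1)) - 1)) \<le> 1 / 2"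
    unfolding \<eta>_\<sigma> .
  obtain N :: nat where N: "1 / \<eta> + 1 \<le> real N" using real_arch_simple by blast
  obtain W where W: "\<And>I F y. finite I \<Longrightarrow> card I \<le> N \<Longrightarrow> tame p (Suc d) I F \<Longrightarrow> y \<in> lp_on p I \<Longrightarrow>
      \<bar>F y - interpolant I F y\<bar> \<le> W"
    using interpolant_close_bounded_dimension[of N thesis] by blast
  show thesis
  proof (rule that[of "2 * W"])
    fix A f x assume A: "finite A" and f: "tame p (Suc d) A f" and x: "x \<in> lp_on p A"
    let ?g = "\<lambda>y. f y - interpolant A f y"
    have g: "tame p (Suc d) A ?g" by (rule tame_residual[OF A f])
    then obtain B where B: "\<And>y. y \<in> lp_on p A \<Longrightarrow> \<bar>?g y\<bar> \<le> B" unfolding tame_def by blast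
    show "\<bar>?g x\<bar> \<le> 2 * W"
    proof (rule sup_halving[where S = "lp_on p A" and g = ?g, OF B _ x])
      fix M z assume "\<And>z. z \<in> lp_on p A \<Longrightarrow> \<bar>?g z\<bar> \<le> M" "z \<in> lp_on p A"
      then show "\<bar>?g z\<bar> \<le> M / 2 + W"
        by (intro grouped_contraction[OF A g coef_residual[OF A] W \<open>\<eta> > 0\<close> N small])
    qed
  qed
qed

end

lemma lp_ball_eq_lp_on: "lp_ball p n = lp_on p {..<n}"
  by (auto simp: lp_ball_def lp_on_def topspace_Euclidean_space not_less)

text \<open>
  The ball is a closed subset of the product of the intervals \<open>{-1..1}\<close>, hence compact by Tychonoff's theorem.
\<close>
lemma cont_funs_bounded_on_lp_ball:
  assumes "f \<in> cont_funs n (lp_ball p n)" "p > 0"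
  obtains B where "\<And>x. x \<in> lp_ball p n \<Longrightarrow> \<bar>f x\<bar> \<le> B"
proof -
  let ?K = "lp_ball p n"
  have "compact (PiE UNIV (\<lambda>_::nat. {-1..1::real}))"
    using compactin_PiE[of "\<lambda>_. euclidean" UNIV "\<lambda>_::nat. {-1..1::real}"]
    by (simp add: euclidean_product_topology)
  moreover have "closed {x :: nat \<Rightarrow> real. (\<Sum>i<n. \<bar>x i\<bar> powr p) \<le> 1}"
    by (intro closed_Collect_le continuous_on_sum continuous_on_powr' continuous_intros)
       (use \<open>p > 0\<close> in auto)
  moreover have "closed {x :: nat \<Rightarrow> real. \<forall>i\<ge>n. x i = 0}"
    by (intro closed_Collect_all closed_Collect_imp closed_Collect_eq continuous_intros) auto
  ultimately have "compact (PiE UNIV (\<lambda>_::nat. {-1..1::real}) \<inter>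
      ({x. (\<Sum>i<n. \<bar>x i\<bar> powr p) \<le> 1} \<inter> {x. \<forall>i\<ge>n. x i = 0}))"
    by (intro compact_Int_closed closed_Int)
  also have "\<dots> = ?K"
    using lp_on_abs_le[of _ p "{..<n}"] \<open>p > 0\<close>
    by (auto simp: lp_ball_eq_lp_on[symmetric] lp_ball_def topspace_Euclidean_space abs_le_iff)
  finally have "compact ?K" .
  moreover have "continuous_on ?K f"
  proof -
    have "subtopology (Euclidean_space n) ?K = subtopology euclidean ?K"
      unfolding Euclidean_space_def euclidean_product_topology subtopology_subtopology
      by (intro arg_cong2[where f = subtopology] refl) (auto simp: lp_ball_def topspace_Euclidean_space)
    then show ?thesis using assms(1) by (simp add: cont_funs_def)
  qed
  ultimately have "compact (f ` ?K)" by (rule compact_continuous_image[rotated])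
  then have "bounded (f ` ?K)" by (rule compact_imp_bounded)
  then obtain B where "\<And>x. x \<in> ?K \<Longrightarrow> \<bar>f x\<bar> \<le> B" by (auto simp: bounded_iff)
  then show thesis by (rule that)
qed

lemma modulus_le_1_imp_tame:
  assumes f: "f \<in> cont_funs n (lp_ball p n)" "modulus n m f (lp_ball p n) \<le> 1" and "p > 0" "m \<ge> 1"
  shows "tame p m {..<n} f"
proof -
  obtain B where B: "\<And>x. x \<in> lp_ball p n \<Longrightarrow> \<bar>f x\<bar> \<le> B"
    using cont_funs_bounded_on_lp_ball[OF f(1) \<open>p > 0\<close>] by blast
  have "\<bar>fin_diff m h f x\<bar> \<le> 1" if mem: "\<forall>j\<le>m. shift x h j \<in> lp_ball p n" for x h
  proof -
    have "shift x h 0 \<in> lp_ball p n" "shift x h 1 \<in> lp_ball p n" using mem \<open>m \<ge> 1\<close> by auto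
    then have "x i = 0" "x i + h i = 0" if "i \<ge> n" for i
      using that by (auto simp: lp_ball_def topspace_Euclidean_space shift_def)
    then have "x \<in> topspace (Euclidean_space n)" "h \<in> topspace (Euclidean_space n)"
      by (force simp: topspace_Euclidean_space)+
    then have "ereal \<bar>fin_diff m h f x\<bar> \<le> modulus n m f (lp_ball p n)"
      unfolding modulus_def using mem by (intro SUP_upper2[of "(x, h)"]) auto
    also have "\<dots> \<le> ereal 1" using f(2) by (simp add: one_ereal_def)
    finally show ?thesis by simp
  qed
  then show ?thesis using B unfolding tame_def lp_ball_eq_lp_on by blast
qed

theorem theorem5p9:
  fixes p :: real and m :: nat
  assumes "0 < p" "p < 1" and "m \<ge> 2"
  shows "\<exists>C::real. \<forall>n\<ge>1. whitney_const_lp m p n \<le> ereal C"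
proof -
  define d where "d = m - 1"
  have m: "m = Suc d" using assms by (simp add: d_def)
  define b where "b = (1 / real (Suc d)) powr (1 / p)"
  have b: "b > 0" "b powr p = 1 / real (Suc d)"
    using assms by (simp_all add: b_def powr_powr)
  define t where "t j = b * real j / real (Suc d)" for j
  have "inj_on t {..d}" using b by (auto simp: inj_on_def t_def)
  then obtain w where w: "\<And>i k. i \<le> d \<Longrightarrow> k \<le> d \<Longrightarrow> (\<Sum>j\<le>d. w k j * t j ^ i) = (if i = k then 1 else 0)"
    using lagrange_weights by metis
  interpret sparse_nodes p d t w
  proof
    fix j assume "j \<le> d"
    then have "b * real j \<le> b * real (Suc d)" using b by (intro mult_left_mono) auto
    then have "\<bar>t j\<bar> \<le> b" using b by (simp add: t_def abs_mult field_simps)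
    then have "\<bar>t j\<bar> powr p \<le> b powr p" using assms by (intro powr_mono2) auto
    then have "real d * \<bar>t j\<bar> powr p \<le> real d * b powr p" by (rule mult_left_mono) simp
    also have "\<dots> \<le> 1" using b by simp
    finally show "real d * \<bar>t j\<bar> powr p \<le> 1" .
  qed (use assms w in auto)
  obtain C where C: "\<And>A f x. finite A \<Longrightarrow> tame p (Suc d) A f \<Longrightarrow> x \<in> lp_on p A \<Longrightarrow>
      \<bar>f x - interpolant A f x\<bar> \<le> C"
    using interpolant_close[of thesis] by blast
  have "whitney_const n m (lp_ball p n) \<le> ereal C" for n
    unfolding whitney_const_def
  proof (rule SUP_least)
    fix f assume "f \<in> {f \<in> cont_funs n (lp_ball p n). modulus n m f (lp_ball p n) \<le> 1}"
    then have f: "tame p (Suc d) {..<n} f"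
      using modulus_le_1_imp_tame[of f n p m] assms m by simp
    have "interpolant {..<n} f \<in> poly_funs n (m - 1)"
      unfolding poly_funs_def interpolant_def degree_indices_lessThan by (auto simp: m)
    then show "best_approx n m f (lp_ball p n) \<le> ereal C"
      unfolding best_approx_def
    proof (rule INF_lower2, intro SUP_least)
      fix x assume "x \<in> lp_ball p n"
      then show "ereal \<bar>f x - interpolant {..<n} f x\<bar> \<le> ereal C"
        using C[OF _ f] by (simp add: lp_ball_eq_lp_on)
    qed
  qed
  then show ?thesis unfolding whitney_const_lp_def by blast
qed

end
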